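(* Suppose that $\mathbf B:\mathbb Z^m\times\mathbb Z^n\to\mathbb Z^p$ is a bilinear map such that for some linear map $L:\mathbb Z^p\to\mathbb Z$, the bilinear form $L\circ\mathbf B$ has rank 1. Then the solvability in the integers of systems of equations of the form $$\sum_{i,j=1}^r a_{ij}^{(q)}\mathbf B(\mathbf u_i,\mathbf v_j)=\mathbf c_q,\qquad q=1,\ldots,s,$$ for unknowns $\mathbf u_i\in\mathbb Z^m$ and $\mathbf v_j\in\mathbb Z^n$, $1\le i,j\le r$, is undecidable.
   Context: The bilinear map $\mathbf B$ is fixed; an instance of the decision problem consists of positive integers $r,s$, integers $a_{ij}^{(q)}$ and vectors $\mathbf c_q\in\mathbb Z^p$. The rank of a bilinear form $\mathbb Z^m\times\mathbb Z^n\to\mathbb Z$ is the rank of its $m\times n$ matrix. Undecidable means that there is no algorithm which, given an instance, decides whether it has a solution. *)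

theory Defs
  imports "HOL-Analysis.Cartesian_Space" "HOL-Library.Nat_Bijection"
begin

section \<open>Partial recursive functions\<close>

text \<open>
  Programs for Kleene's partial recursive functions with their graph semantics:
  \<open>rec_eval f xs y\<close> says that \<open>f\<close> halts on the argument tuple \<open>xs\<close> with output \<open>y\<close>.
  Arities are implicit: a program applied to a tuple of an unsuitable length may have no value.
  \<open>PrimRec\<close> recurses on the first argument, and the step program receives the
  predecessor, the previous value and the parameters, in that order.
  \<open>Mu f\<close> yields the least \<open>n\<close> with value 0, all smaller arguments having a nonzero value.
\<close>

datatype recf =
    Zero
  | Succ
  | Proj nat
  | Comp recf "recf list"
  | PrimRec recf recf
  | Mu recf

inductive rec_eval :: "recf \<Rightarrow> nat list \<Rightarrow> nat \<Rightarrow> bool" where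
  Zero: "rec_eval Zero xs 0"
| Succ: "rec_eval Succ [x] (Suc x)"
| Proj: "i < length xs \<Longrightarrow> rec_eval (Proj i) xs (xs ! i)"
| Comp: "length ys = length gs \<Longrightarrow> (\<forall>i<length gs. rec_eval (gs ! i) xs (ys ! i)) \<Longrightarrow>
    rec_eval f ys z \<Longrightarrow> rec_eval (Comp f gs) xs z"
| PrimRec_0: "rec_eval f xs y \<Longrightarrow> rec_eval (PrimRec f g) (0 # xs) y"
| PrimRec_Suc: "rec_eval (PrimRec f g) (n # xs) y \<Longrightarrow> rec_eval g (n # y # xs) z \<Longrightarrow>
    rec_eval (PrimRec f g) (Suc n # xs) z"
| Mu: "rec_eval f (n # xs) 0 \<Longrightarrow> (\<forall>k<n. \<exists>y. rec_eval f (k # xs) (Suc y)) \<Longrightarrow>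
    rec_eval (Mu f) xs n"

lemma rec_eval_deterministic:
  "rec_eval f xs y \<Longrightarrow> rec_eval f xs y' \<Longrightarrow> y = y'"
proof (induction arbitrary: y' rule: rec_eval.induct)
  case (Zero xs)
  then show ?case by cases simp
next
  case (Succ x)
  then show ?case by cases simp
next
  case (Proj i xs)
  from Proj.prems show ?case by cases simp
next
  case (Comp ys gs xs f z)
  from Comp.prems show ?case
  proof cases
    case A: (Comp ys')
    have "ys = ys'"
    proof (rule nth_equalityI)
      show "length ys = length ys'" using Comp.hyps(1) A(1) by simp
      show "ys ! i = ys' ! i" if "i < length ys" for i
        using that Comp.hyps(1) Comp.IH(1) A(2) by simp
    qed
    with A(3) have "rec_eval f ys y'" by simp
    then show ?thesis by (rule Comp.IH(2))
  qed
next
  case (PrimRec_0 f xs y g)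
  from PrimRec_0.prems have "rec_eval f xs y'" by cases
  then show ?case by (rule PrimRec_0.IH)
next
  case (PrimRec_Suc f g n xs y z)
  from PrimRec_Suc.prems show ?case
  proof cases
    case A: (PrimRec_Suc w)
    have "y = w" using A(1) by (rule PrimRec_Suc.IH(1))
    with A(2) have "rec_eval g (n # y # xs) y'" by simp
    then show ?thesis by (rule PrimRec_Suc.IH(2))
  qed
next
  case (Mu f n xs)
  from Mu.prems show ?case
  proof cases
    case A: Mu
    have "\<not> y' < n"
    proof
      assume "y' < n"
      with Mu.IH(2) obtain y where "\<forall>z. rec_eval f (y' # xs) z \<longrightarrow> Suc y = z" by auto
      with A(1) have "Suc y = 0" by simp
      then show False by simp
    qed
    moreover have "\<not> n < y'"
    proof
      assume "n < y'"
      with A(2) obtain y where "rec_eval f (n # xs) (Suc y)" by auto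
      then have "0 = Suc y" by (rule Mu.IH(1))
      then show False by simp
    qed
    ultimately show ?thesis by simp
  qed
qed

section \<open>Decision problems\<close>

text \<open>
  A decision problem consists of a set \<open>I\<close> of instances, a coding of instances by natural
  numbers, and the property \<open>P\<close> to be decided. An algorithm must halt with the correct answer
  on the code of every instance; on numbers that code no instance its behaviour is irrelevant.
\<close>

definition decides :: "recf \<Rightarrow> 'i set \<Rightarrow> ('i \<Rightarrow> nat) \<Rightarrow> ('i \<Rightarrow> bool) \<Rightarrow> bool" where
  "decides f I code P \<longleftrightarrow> (\<forall>x\<in>I. rec_eval f [code x] (if P x then 1 else 0))"

definition undecidable :: "'i set \<Rightarrow> ('i \<Rightarrow> nat) \<Rightarrow> ('i \<Rightarrow> bool) \<Rightarrow> bool" where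
  "undecidable I code P \<longleftrightarrow> \<not> (\<exists>f. decides f I code P)"

section \<open>Bilinear maps over the integers\<close>

definition int_linear :: "(int^'m \<Rightarrow> int^'p) \<Rightarrow> bool" where
  "int_linear F \<longleftrightarrow> module_hom (*s) (*s) F"

definition int_functional :: "(int^'p \<Rightarrow> int) \<Rightarrow> bool" where
  "int_functional L \<longleftrightarrow> module_hom (*s) (*) L"

definition int_bilinear :: "(int^'m \<Rightarrow> int^'n \<Rightarrow> int^'p) \<Rightarrow> bool" where
  "int_bilinear B \<longleftrightarrow> (\<forall>v. int_linear (\<lambda>u. B u v)) \<and> (\<forall>u. int_linear (B u))"

text \<open>
  The library's \<^const>\<open>rank\<close> is for matrices over a field; the rank of an integer matrix is
  its rank over the rationals.
\<close>

definition form_matrix :: "(int^'m \<Rightarrow> int^'n \<Rightarrow> int) \<Rightarrow> int^'n^'m" where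
  "form_matrix b = (\<chi> i j. b (axis i 1) (axis j 1))"

definition form_rank :: "(int^'m \<Rightarrow> int^'n \<Rightarrow> int) \<Rightarrow> nat" where
  "form_rank b = rank (\<chi> i j. rat_of_int (form_matrix b $ i $ j))"

section \<open>Systems of bilinear equations\<close>

text \<open>
  The parameters \<open>r\<close>, \<open>s\<close>, the coefficients \<open>a q i j\<close> and the right-hand sides \<open>c q\<close>, with
  indices starting from 0. Only the values for \<open>q < s\<close> and \<open>i, j < r\<close> are ever used.
\<close>

record ('p::finite) bilinear_system =
  sys_r :: nat
  sys_s :: nat
  sys_a :: "nat \<Rightarrow> nat \<Rightarrow> nat \<Rightarrow> int"
  sys_c :: "nat \<Rightarrow> int^'p"

definition bilinear_systems :: "'p::finite bilinear_system set" where
  "bilinear_systems = {S. sys_r S > 0 \<and> sys_s S > 0}"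

definition solvable ::
    "(int^'m \<Rightarrow> int^'n \<Rightarrow> int^'p) \<Rightarrow> 'p bilinear_system \<Rightarrow> bool" where
  "solvable B S \<longleftrightarrow> (\<exists>(u :: nat \<Rightarrow> int^'m) (v :: nat \<Rightarrow> int^'n).
     \<forall>q<sys_s S. (\<Sum>i<sys_r S. \<Sum>j<sys_r S. sys_a S q i j *s B (u i) (v j)) = sys_c S q)"

text \<open>
  To write a vector as a list of integers, the coordinates are listed in an arbitrary but fixed
  order. Since the dimension is fixed, two such orders differ by a fixed permutation, so that the
  choice does not affect decidability.
\<close>

definition index_list :: "'p::finite list" where
  "index_list = (SOME xs. distinct xs \<and> set xs = UNIV)"

lemma index_list: "distinct (index_list :: 'p::finite list)" "set (index_list :: 'p list) = UNIV"
proof -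
  have "\<exists>xs :: 'p list. distinct xs \<and> set xs = UNIV"
    using finite_distinct_list[of "UNIV :: 'p set"] by auto
  then have "distinct (index_list :: 'p list) \<and> set (index_list :: 'p list) = UNIV"
    unfolding index_list_def by (rule someI_ex)
  then show "distinct (index_list :: 'p list)" "set (index_list :: 'p list) = UNIV"
    by blast+
qed

definition coords :: "int^'p \<Rightarrow> int list" where
  "coords x = map (\<lambda>k. x $ k) index_list"

definition system_data :: "'p::finite bilinear_system \<Rightarrow> int list" where
  "system_data S = concat (map (\<lambda>q.
     concat (map (\<lambda>i. map (\<lambda>j. sys_a S q i j) [0..<sys_r S]) [0..<sys_r S])
     @ coords (sys_c S q)) [0..<sys_s S])"

definition system_code :: "'p::finite bilinear_system \<Rightarrow> nat" where
  "system_code S = list_encode (sys_r S # sys_s S # map int_encode (system_data S))"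

end

theory Submission
  imports Defs "HOL-Number_Theory.Number_Theory"
begin

text \<open>
  Choose \<open>e\<close>, \<open>f\<close> with \<open>\<bar>L (B e f)\<bar>\<close> minimal among the nonzero values. As \<open>L \<circ> B\<close> has rank 1, it is
  \<open>d * X u * Y v\<close> with \<open>d = L (B e f)\<close> and \<open>X e = Y f = 1\<close>. With right-hand sides that are multiples of
  \<open>B e f\<close>, applying \<open>L\<close> in one direction and substituting multiples of \<open>e\<close> and \<open>f\<close> in the other
  reduces the problem to integer equations \<open>\<Sum> a i j * x i * y j = k\<close>. Such systems express all
  Diophantine equations: \<open>x 0 * y 0 = 1\<close> gives a unit, and \<open>x i * y 0 = x 0 * y i\<close> identifies \<open>x\<close>
  with \<open>y\<close>; four squares restrict the variables to the natural numbers.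

  By the theorem of Davis, Putnam, Robinson and Matiyasevich, graphs of partial recursive
  functions are Diophantine. Exponentiation is handled by the Pell equation, and bounded universal
  quantifiers by a Chinese remainder coding whose moduli multiply to a binomial coefficient.

  The contradiction is a diagonal argument that needs neither a universal function nor any programming.
  A parameter \<open>n\<close> enters a system only as its very first coefficient, so that the code of the
  system is a fixed polynomial expression in \<open>n\<close> and three numbers \<open>r\<close>, \<open>s\<close>, \<open>t\<close>. If \<open>F\<close> were a decision
  procedure, then the set of all \<open>n\<close> coding a triple \<open>(r, s, t)\<close> such that \<open>F\<close> answers 0 on the system
  with data \<open>(r, s, t)\<close> and parameter \<open>n\<close> would be Diophantine, hence given by such a system; its own
  triple is a contradiction.
\<close>

section \<open>Diophantine relations\<close>

text \<open>Auxiliary variables split any polynomial equation into these three shapes, and each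
  shape becomes a single bilinear equation in \<open>atom_equation\<close>.\<close>

datatype atom = Add nat nat nat | Mul nat nat nat | One nat

text \<open>The same atoms are read over the natural numbers first and over the integers later,
  hence the general semiring.\<close>

fun holds :: "(nat \<Rightarrow> 'a::comm_semiring_1) \<Rightarrow> atom \<Rightarrow> bool" where
  "holds v (Add i j k) \<longleftrightarrow> v i + v j = v k"
| "holds v (Mul i j k) \<longleftrightarrow> v i * v j = v k"
| "holds v (One i) \<longleftrightarrow> v i = 1"

fun vars :: "atom \<Rightarrow> nat set" where
  "vars (Add i j k) = {i, j, k}"
| "vars (Mul i j k) = {i, j, k}"
| "vars (One i) = {i}"

lemma holds_cong: "(\<And>i. i \<in> vars A \<Longrightarrow> v i = w i) \<Longrightarrow> holds v A \<longleftrightarrow> holds w A"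
  by (cases A) auto

text \<open>Environments are infinite, so that no arities have to be tracked;
  \<open>dioph_finite_support\<close> recovers the finiteness. A quantifier overwrites one
  slot.\<close>

inductive dioph :: "((nat \<Rightarrow> nat) \<Rightarrow> bool) \<Rightarrow> bool" where
  dioph_atom: "dioph (\<lambda>v. holds v A)"
| dioph_conj: "dioph P \<Longrightarrow> dioph Q \<Longrightarrow> dioph (\<lambda>v. P v \<and> Q v)"
| dioph_upd: "dioph P \<Longrightarrow> dioph (\<lambda>v. \<exists>x. P (v(n := x)))"

lemma dioph_finite_support:
  assumes "dioph P"
  obtains N where "\<And>v w. (\<And>i. i < N \<Longrightarrow> v i = w i) \<Longrightarrow> P v \<longleftrightarrow> P w"
proof -
  have "\<exists>N. \<forall>v w. (\<forall>i<N. v i = w i) \<longrightarrow> (P v \<longleftrightarrow> P w)"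
    using assms
  proof induction
    case (dioph_atom A)
    have "finite (vars A)" by (cases A) auto
    then obtain N where "\<forall>i\<in>vars A. i < N" by (metis finite_nat_set_iff_bounded)
    then show ?case by (intro exI[of _ N]) (metis holds_cong)
  next
    case (dioph_conj P Q)
    then obtain N N' where
      "\<forall>v w. (\<forall>i<N. v i = w i) \<longrightarrow> (P v \<longleftrightarrow> P w)" "\<forall>v w. (\<forall>i<N'. v i = w i) \<longrightarrow> (Q v \<longleftrightarrow> Q w)"
      by blast
    then show ?case by (intro exI[of _ "max N N'"]) (metis less_max_iff_disj)
  next
    case (dioph_upd P n)
    then obtain N where N: "\<forall>v w. (\<forall>i<N. v i = w i) \<longrightarrow> (P v \<longleftrightarrow> P w)" by blast
    have "P (v(n := x)) \<longleftrightarrow> P (w(n := x))" if "\<forall>i<N. v i = w i" for v w x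
      using N[rule_format, of "v(n := x)" "w(n := x)"] that by simp
    then show ?case by (intro exI[of _ N]) blast
  qed
  then show thesis using that by blast
qed

lemma dioph_rename: "dioph P \<Longrightarrow> dioph (\<lambda>v. P (\<lambda>i. v (\<rho> i)))"
proof (induction arbitrary: \<rho> rule: dioph.induct)
  case (dioph_atom A)
  obtain B where "\<And>v :: nat \<Rightarrow> nat. holds (\<lambda>i. v (\<rho> i)) A \<longleftrightarrow> holds v B"
  proof (cases A)
    case (Add i j k) then show ?thesis using that[of "Add (\<rho> i) (\<rho> j) (\<rho> k)"] by simp
  next
    case (Mul i j k) then show ?thesis using that[of "Mul (\<rho> i) (\<rho> j) (\<rho> k)"] by simp
  next
    case (One i) then show ?thesis using that[of "One (\<rho> i)"] by simp
  qed
  then show ?case by (simp add: dioph.dioph_atom)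
next
  case (dioph_conj P Q)
  then show ?case by (intro dioph.dioph_conj)
next
  case (dioph_upd P n)
  obtain N where N: "\<And>v w. (\<And>i. i < N \<Longrightarrow> v i = w i) \<Longrightarrow> P v \<longleftrightarrow> P w"
    using dioph_finite_support[OF dioph_upd.hyps] by blast
  \<comment> \<open>\<open>m\<close> lies beyond the renamed support, so the bound variable is not
    captured when it moves from slot \<open>n\<close> to slot \<open>m\<close>.\<close>
  obtain m where m: "\<forall>i\<in>\<rho> ` {..<N}. i < m"
    by (metis finite_nat_set_iff_bounded finite_imageI finite_lessThan)
  define \<rho>' where "\<rho>' = \<rho>(n := m)"
  have "P ((\<lambda>i. v (\<rho> i))(n := x)) \<longleftrightarrow> P (\<lambda>i. (v(m := x)) (\<rho>' i))" for v x
    by (rule N) (use m in \<open>auto simp: \<rho>'_def\<close>)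
  with dioph.dioph_upd[OF dioph_upd.IH[of \<rho>'], of m] show ?case by simp
qed

text \<open>De Bruijn form of quantification: the witness sits in slot 0 and all other slots move up
  by one. It reduces to \<open>dioph_upd\<close> by keeping the witness in a slot \<open>N\<close>
  beyond the support.\<close>

lemma dioph_ex:
  assumes "dioph (\<lambda>v. P (v 0) (\<lambda>i. v (Suc i)))"
  shows "dioph (\<lambda>v. \<exists>x. P x v)"
proof -
  obtain N where N: "\<And>v w. (\<And>i. i < N \<Longrightarrow> v i = w i) \<Longrightarrow>
      P (v 0) (\<lambda>i. v (Suc i)) \<longleftrightarrow> P (w 0) (\<lambda>i. w (Suc i))"
    using dioph_finite_support[OF assms] by blast
  define \<rho> where "\<rho> = (\<lambda>i. case i of 0 \<Rightarrow> N | Suc j \<Rightarrow> j)"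
  have eq: "P x (v(N := x)) \<longleftrightarrow> P x v" for x v
  proof -
    have "case_nat x (v(N := x)) i = case_nat x v i" if "i < N" for i
      using that by (simp split: nat.split)
    then show ?thesis using N[of "case_nat x (v(N := x))" "case_nat x v"] by (simp add: fun_upd_def)
  qed
  have "dioph (\<lambda>v. P (v N) v)"
    using dioph_rename[OF assms, of \<rho>] by (simp add: \<rho>_def)
  from dioph_upd[OF this, of N] show ?thesis by (simp add: eq)
qed

section \<open>Diophantine functions and substitution\<close>

definition dfun :: "((nat \<Rightarrow> nat) \<Rightarrow> nat) \<Rightarrow> bool" where
  "dfun f \<longleftrightarrow> dioph (\<lambda>v. v 0 = f (\<lambda>i. v (Suc i)))"

lemma dioph_add: "dioph (\<lambda>v. v i + v j = v k)"
  using dioph_atom[of "Add i j k"] by simp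

lemma dioph_mul: "dioph (\<lambda>v. v i * v j = v k)"
  using dioph_atom[of "Mul i j k"] by simp

lemma dioph_one: "dioph (\<lambda>v. v i = 1)"
  using dioph_atom[of "One i"] by simp

lemma dioph_zero: "dioph (\<lambda>v. v i = 0)"
  using dioph_add[of i i i] by simp

lemma dioph_eq_var: "dioph (\<lambda>v. v i = v j)"
proof -
  have "dioph (\<lambda>v. \<exists>x. x = 0 \<and> v i + x = v j)"
    by (rule dioph_ex) (intro dioph_conj dioph_zero dioph_add)
  then show ?thesis by simp
qed

lemma dfun_var: "dfun (\<lambda>v. v i)"
  unfolding dfun_def by (rule dioph_eq_var)

lemma dfun_shift: "dfun f \<Longrightarrow> dioph (\<lambda>v. v j = f (\<lambda>i. v (\<rho> i)))"
  unfolding dfun_def by (drule dioph_rename[of _ "case_nat j \<rho>"]) simp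

lemma dfun_rename: "dfun f \<Longrightarrow> dfun (\<lambda>v. f (\<lambda>i. v (\<rho> i)))"
  by (subst dfun_def) (rule dfun_shift)

lemma dfun_Suc: "dfun f \<Longrightarrow> dfun (\<lambda>v. f (\<lambda>i. v (Suc i)))"
  by (rule dfun_rename)

text \<open>An existential quantifier names the value of \<open>f\<close>, which turns a composition
  into a conjunction.\<close>

lemma dioph_subst1:
  assumes "dioph (\<lambda>v. R (v 0) (\<lambda>i. v (Suc i)))" "dfun f"
  shows "dioph (\<lambda>v. R (f v) v)"
proof -
  have "dioph (\<lambda>v. \<exists>x. x = f v \<and> R x v)"
    by (rule dioph_ex) (intro dioph_conj dfun_shift assms)
  then show ?thesis by simp
qed

lemma dioph_rel2:
  assumes "dioph (\<lambda>v. R (v 0) (v 1))" "dfun f" "dfun g"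
  shows "dioph (\<lambda>v. R (f v) (g v))"
proof -
  have "dioph (\<lambda>v. R (v 0) (g (\<lambda>i. v (Suc i))))"
    by (rule dioph_subst1[of "\<lambda>y v. R (v 0) y"])
       (use dioph_rename[OF assms(1), of "\<lambda>i. if i = 0 then 1 else 0"] dfun_rename[OF assms(3)] in simp_all)
  from dioph_subst1[of "\<lambda>x v. R x (g v)", OF this assms(2)] show ?thesis .
qed

lemma dioph_rel3:
  assumes "dioph (\<lambda>v. R (v 0) (v 1) (v 2))" "dfun f" "dfun g" "dfun h"
  shows "dioph (\<lambda>v. R (f v) (g v) (h v))"
proof -
  have "dioph (\<lambda>v. R (v 0) (v 1) (h (\<lambda>i. v (Suc (Suc i)))))"
    by (rule dioph_subst1[of "\<lambda>y v. R (v 0) (v 1) y"])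
       (use dioph_rename[OF assms(1), of "\<lambda>i. if i = 0 then 1 else if i = 1 then 2 else 0"] 
         dfun_rename[OF assms(4)] in \<open>simp_all add: numeral_2_eq_2\<close>)
  then have "dioph (\<lambda>v. R (v 1) (v 0) (h (\<lambda>i. v (Suc (Suc i)))))"
    by (drule_tac dioph_rename[of _ "\<lambda>i. if i = 0 then 1 else if i = 1 then 0 else i"]) simp
  then have "dioph (\<lambda>v. R (v 0) (g (\<lambda>i. v (Suc i))) (h (\<lambda>i. v (Suc i))))"
    by (intro dioph_subst1[of "\<lambda>y v. R (v 0) y (h (\<lambda>i. v (Suc i)))"])
       (use dfun_rename[OF assms(3)] in simp_all)
  from dioph_subst1[of "\<lambda>x v. R x (g v) (h v)", OF this assms(2)] show ?thesis .
qed

lemma dfunI2: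
  assumes "dioph (\<lambda>v. v 2 = F (v 0) (v 1))" "dfun f" "dfun g"
  shows "dfun (\<lambda>v. F (f v) (g v))"
  unfolding dfun_def
  by (rule dioph_rel3[of "\<lambda>x y z. z = F x y"]) (use assms in \<open>simp_all add: dfun_var dfun_Suc\<close>)

lemma dfun_add: "dfun f \<Longrightarrow> dfun g \<Longrightarrow> dfun (\<lambda>v. f v + g v)"
  by (rule dfunI2) (use dioph_add in \<open>simp_all add: eq_commute\<close>)

lemma dfun_mult: "dfun f \<Longrightarrow> dfun g \<Longrightarrow> dfun (\<lambda>v. f v * g v)"
  by (rule dfunI2) (use dioph_mul in \<open>simp_all add: eq_commute\<close>)

lemma dfun_const: "dfun (\<lambda>v. c)"
proof (induction c)
  case 0
  then show ?case unfolding dfun_def by (rule dioph_zero)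
next
  case (Suc c)
  have "dfun (\<lambda>v. 1)" unfolding dfun_def by (rule dioph_one)
  from dfun_add[OF Suc this] show ?case by simp
qed

lemma dfun_SucI: "dfun f \<Longrightarrow> dfun (\<lambda>v. Suc (f v))"
  using dfun_add[OF _ dfun_const[of 1], of f] by simp

lemma dioph_eq: "dfun f \<Longrightarrow> dfun g \<Longrightarrow> dioph (\<lambda>v. f v = g v)"
  by (rule dioph_rel2[of "(=)"]) (rule dioph_eq_var)

lemma dioph_True: "dioph (\<lambda>v. True)"
  using dioph_eq_var[of 0 0] by simp

lemma dioph_False: "dioph (\<lambda>v. False)"
  using dioph_eq[OF dfun_const[of 0] dfun_const[of 1]] by simp

lemma dioph_const: "dioph (\<lambda>v. b)"
  by (cases b) (simp_all add: dioph_True dioph_False)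

lemma dioph_conj_const: "(b \<Longrightarrow> dioph P) \<Longrightarrow> dioph (\<lambda>v. b \<and> P v)"
  by (cases b) (simp_all add: dioph_False)

lemma dioph_disj_const: "dioph P \<Longrightarrow> dioph (\<lambda>v. b \<or> P v)"
  by (cases b) (simp_all add: dioph_True)

text \<open>With these rules, writing a relation by means of existential quantifiers and earlier
  Diophantine notions already proves it Diophantine. Under a quantifier the given functions occur
  with shifted slots, which \<open>dfun_rename\<close> covers.\<close>

named_theorems dioph_intros

lemmas [dioph_intros] =
  dioph_const dioph_disj_const dioph_conj dioph_ex dioph_eq dfun_const dfun_var dfun_add dfun_mult dfun_SucI

lemma dioph_le[dioph_intros]:
  assumes "dfun f" "dfun g" shows "dioph (\<lambda>v. f v \<le> g v)"
proof -
  have "dioph (\<lambda>v. \<exists>x. f v + x = g v)"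
    by (intro dioph_intros assms assms(1,2)[THEN dfun_rename])
  then show ?thesis by (simp add: le_iff_add eq_commute)
qed

lemma dioph_less[dioph_intros]:
  assumes "dfun f" "dfun g" shows "dioph (\<lambda>v. f v < g v)"
  unfolding less_eq_Suc_le by (intro dioph_intros assms assms(1,2)[THEN dfun_rename])

lemma dioph_cong[dioph_intros]:
  assumes "dfun f" "dfun g" "dfun h" shows "dioph (\<lambda>v. [f v = g v] (mod h v))"
proof -
  \<comment> \<open>Multiples of the modulus are added on both sides, since subtraction of natural
    numbers is truncated.\<close>
  have eq: "[a = b] (mod m) \<longleftrightarrow> (\<exists>s t. a + s * m = b + t * m)" for a b m :: nat
    by (metis cong_iff_lin_nat)
  show ?thesis unfolding eq by (intro dioph_intros assms assms[THEN dfun_rename])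
qed

lemma dioph_dvd[dioph_intros]:
  assumes "dfun f" "dfun g" shows "dioph (\<lambda>v. f v dvd g v)"
  unfolding dvd_def by (intro dioph_intros assms assms(1,2)[THEN dfun_rename])

lemma dfun_mod[dioph_intros]:
  assumes "dfun f" "dfun g" "\<And>v. g v > 0" shows "dfun (\<lambda>v. f v mod g v)"
proof -
  have eq: "z = a mod b \<longleftrightarrow> z < b \<and> [z = a] (mod b)" if "b > 0" for z a b :: nat
    using that by (auto simp: cong_def)
  show ?thesis unfolding dfun_def eq[OF assms(3)] by (intro dioph_intros assms assms(1,2)[THEN dfun_rename])
qed

lemma dfun_div[dioph_intros]:
  assumes "dfun f" "dfun g" "\<And>v. g v > 0" shows "dfun (\<lambda>v. f v div g v)"
proof -
  have eq: "z = a div b \<longleftrightarrow> z * b \<le> a \<and> a < Suc z * b" if "b > 0" for z a b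
    using less_eq_div_iff_mult_less_eq[of b z a] div_less_iff_less_mult[of b a "Suc z"] that by auto
  show ?thesis unfolding dfun_def eq[OF assms(3)] by (intro dioph_intros assms assms(1,2)[THEN dfun_rename])
qed


text \<open>Infinitely many slots are quantified at once, but only those below the support bound
  \<open>N\<close> matter. Quantifying slots \<open>M\<close> to \<open>M + N - 1\<close> one by one
  is enough.\<close>

lemma dioph_ex_block:
  assumes "dioph Q"
  shows "dioph (\<lambda>v. \<exists>w. (\<forall>i<M. w i = v i) \<and> Q w)"
proof -
  obtain N where N: "\<And>v w. (\<And>i. i < N \<Longrightarrow> v i = w i) \<Longrightarrow> Q v \<longleftrightarrow> Q w"
    using dioph_finite_support[OF assms] by blast
  have "dioph (\<lambda>v. \<exists>w. (\<forall>i. i < M \<or> M + d \<le> i \<longrightarrow> w i = v i) \<and> Q w)" for d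
  proof (induction d)
    case 0
    have "(\<exists>w. (\<forall>i. i < M \<or> M + 0 \<le> i \<longrightarrow> w i = v i) \<and> Q w) \<longleftrightarrow> Q v" for v
      by (metis add_0_right ext not_le)
    then show ?case using assms by simp
  next
    case (Suc d)
    have "(\<exists>x w. (\<forall>i. i < M \<or> M + d \<le> i \<longrightarrow> w i = (v(M + d := x)) i) \<and> Q w) \<longleftrightarrow>
        (\<exists>w. (\<forall>i. i < M \<or> M + Suc d \<le> i \<longrightarrow> w i = v i) \<and> Q w)" (is "?L \<longleftrightarrow> ?R") for v
    proof
      assume ?L
      then obtain x w where w: "\<forall>i. i < M \<or> M + d \<le> i \<longrightarrow> w i = (v(M + d := x)) i" "Q w" by blast
      have "\<forall>i. i < M \<or> M + Suc d \<le> i \<longrightarrow> w i = v i" using w(1) by auto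
      with w(2) show ?R by blast
    next
      assume ?R
      then obtain w where w: "\<forall>i. i < M \<or> M + Suc d \<le> i \<longrightarrow> w i = v i" "Q w" by blast
      have "\<forall>i. i < M \<or> M + d \<le> i \<longrightarrow> w i = (v(M + d := w (M + d))) i" using w(1) by auto
      with w(2) show ?L by blast
    qed
    with dioph_upd[OF Suc, of "M + d"] show ?case by simp
  qed
  from this[of N] have "dioph (\<lambda>v. \<exists>w. (\<forall>i. i < M \<or> M + N \<le> i \<longrightarrow> w i = v i) \<and> Q w)" .
  moreover have "(\<exists>w. (\<forall>i. i < M \<or> M + N \<le> i \<longrightarrow> w i = v i) \<and> Q w) \<longleftrightarrow>
      (\<exists>w. (\<forall>i<M. w i = v i) \<and> Q w)" (is "?L \<longleftrightarrow> ?R") for v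
  proof
    assume ?R
    then obtain w where w: "\<forall>i<M. w i = v i" "Q w" by blast
    let ?w = "\<lambda>i. if i < M + N then w i else v i"
    have "Q ?w" using N[of w ?w] w(2) by simp
    moreover have "\<forall>i. i < M \<or> M + N \<le> i \<longrightarrow> ?w i = v i" using w(1) by auto
    ultimately show ?L by (intro exI[of _ ?w] conjI)
  qed blast
  ultimately show ?thesis by simp
qed

text \<open>Prenex normal form, with a finite list of atoms as matrix. The induction leaves
  \<open>\<rho>\<close> and \<open>M\<close> arbitrary, so that the auxiliary variables of the
  second conjunct can be numbered after those of the first.\<close>

lemma dioph_prenex:
  assumes "dioph P" "\<And>i. \<rho> i < M"
  obtains E M' where "M \<le> M'" "\<And>A. A \<in> set E \<Longrightarrow> vars A \<subseteq> {..<M'}"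
    "\<And>v. P (\<lambda>i. v (\<rho> i)) \<longleftrightarrow> (\<exists>w. (\<forall>i<M. w i = v i) \<and> (\<forall>A\<in>set E. holds w A))"
proof -
  have "\<exists>E M'. M \<le> M' \<and> (\<forall>A\<in>set E. vars A \<subseteq> {..<M'}) \<and>
    (\<forall>v. P (\<lambda>i. v (\<rho> i)) \<longleftrightarrow> (\<exists>w. (\<forall>i<M. w i = v i) \<and> (\<forall>A\<in>set E. holds w A)))"
    using assms
  proof (induction arbitrary: \<rho> M rule: dioph.induct)
    case (dioph_atom A)
    define B where "B = (case A of Add i j k \<Rightarrow> Add (\<rho> i) (\<rho> j) (\<rho> k)
      | Mul i j k \<Rightarrow> Mul (\<rho> i) (\<rho> j) (\<rho> k) | One i \<Rightarrow> One (\<rho> i))"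
    have B: "vars B \<subseteq> {..<M}" "\<And>v :: nat \<Rightarrow> nat. holds (\<lambda>i. v (\<rho> i)) A \<longleftrightarrow> holds v B"
      using dioph_atom by (auto simp: B_def split: atom.splits)
    have eq: "holds v B \<longleftrightarrow> (\<exists>w. (\<forall>i<M. w i = v i) \<and> holds w B)" for v :: "nat \<Rightarrow> nat"
      using holds_cong[of B] B(1) by (metis lessThan_iff subsetD)
    show ?case
    proof (intro exI[of _ "[B]"] exI[of _ M] conjI allI)
      fix v :: "nat \<Rightarrow> nat"
      show "holds (\<lambda>i. v (\<rho> i)) A \<longleftrightarrow>
          (\<exists>w. (\<forall>i<M. w i = v i) \<and> (\<forall>A\<in>set [B]. holds w A))"
        using B(2)[of v] eq[of v] by auto
    qed (use B(1) in auto)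
  next
    case (dioph_conj P Q)
    obtain E1 M1 where 1: "M \<le> M1" "\<forall>A\<in>set E1. vars A \<subseteq> {..<M1}"
      "\<And>v. P (\<lambda>i. v (\<rho> i)) \<longleftrightarrow> (\<exists>w. (\<forall>i<M. w i = v i) \<and> (\<forall>A\<in>set E1. holds w A))"
      using dioph_conj.IH(1)[of \<rho> M, OF dioph_conj.prems] by blast
    have "\<rho> i < M1" for i using 1(1) dioph_conj.prems[of i] by simp
    from dioph_conj.IH(2)[of \<rho> M1, OF this]
    obtain E2 M2 where 2: "M1 \<le> M2" "\<forall>A\<in>set E2. vars A \<subseteq> {..<M2}"
      "\<And>v. Q (\<lambda>i. v (\<rho> i)) \<longleftrightarrow> (\<exists>w. (\<forall>i<M1. w i = v i) \<and> (\<forall>A\<in>set E2. holds w A))"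
      by blast
    show ?case
    proof (intro exI[of _ "E1 @ E2"] exI[of _ M2] conjI allI)
      show "M \<le> M2" using 1(1) 2(1) by simp
      show "\<forall>A\<in>set (E1 @ E2). vars A \<subseteq> {..<M2}" using 1(2) 2(1,2) by fastforce
      fix v :: "nat \<Rightarrow> nat"
      show "P (\<lambda>i. v (\<rho> i)) \<and> Q (\<lambda>i. v (\<rho> i)) \<longleftrightarrow>
        (\<exists>w. (\<forall>i<M. w i = v i) \<and> (\<forall>A\<in>set (E1 @ E2). holds w A))" (is "?L \<longleftrightarrow> ?R")
      proof
        assume ?L
        then obtain w1 where w1: "\<forall>i<M. w1 i = v i" "\<forall>A\<in>set E1. holds w1 A"
          using 1(3) by blast
        then have "(\<lambda>i. v (\<rho> i)) = (\<lambda>i. w1 (\<rho> i))" using dioph_conj.prems by simp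
        with \<open>?L\<close> have "Q (\<lambda>i. w1 (\<rho> i))" by simp
        then obtain w2 where w2: "\<forall>i<M1. w2 i = w1 i" "\<forall>A\<in>set E2. holds w2 A"
          using 2(3) by blast
        have "holds w2 A" if "A \<in> set E1" for A
          using holds_cong[of A w1 w2] w1(2) w2(1) 1(2) that by fastforce
        with w1(1) w2 1(1) show ?R by (intro exI[of _ w2]) auto
      next
        assume ?R
        then obtain w where w: "\<forall>i<M. w i = v i" "\<forall>A\<in>set (E1 @ E2). holds w A" by blast
        then have "(\<lambda>i. v (\<rho> i)) = (\<lambda>i. w (\<rho> i))" using dioph_conj.prems by simp
        moreover have "Q (\<lambda>i. w (\<rho> i))" using 2(3)[of w] w(2) by auto
        moreover have "P (\<lambda>i. v (\<rho> i))" using 1(3)[of v] w by auto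
        ultimately show ?L by simp
      qed
    qed
  next
    case (dioph_upd P n)
    \<comment> \<open>The bound variable receives the first free slot \<open>M\<close>.\<close>
    have "(\<rho>(n := M)) i < Suc M" for i using dioph_upd.prems[of i] by simp
    from dioph_upd.IH[of "\<rho>(n := M)" "Suc M", OF this] obtain E M' where E: "Suc M \<le> M'" "\<forall>A\<in>set E. vars A \<subseteq> {..<M'}"
      "\<And>v. P (\<lambda>i. v ((\<rho>(n := M)) i)) \<longleftrightarrow>
        (\<exists>w. (\<forall>i<Suc M. w i = v i) \<and> (\<forall>A\<in>set E. holds w A))" by blast
    have eq: "P ((\<lambda>i. v (\<rho> i))(n := x)) \<longleftrightarrow>
      (\<exists>w. (\<forall>i<Suc M. w i = (v(M := x)) i) \<and> (\<forall>A\<in>set E. holds w A))" for v x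
    proof -
      have "(\<lambda>i. v (\<rho> i))(n := x) = (\<lambda>i. (v(M := x)) ((\<rho>(n := M)) i))"
        using dioph_upd.prems by (auto simp: fun_eq_iff)
      with E(3)[of "v(M := x)"] show ?thesis by argo
    qed
    have "(\<exists>x. P ((\<lambda>i. v (\<rho> i))(n := x))) \<longleftrightarrow>
      (\<exists>w. (\<forall>i<M. w i = v i) \<and> (\<forall>A\<in>set E. holds w A))" (is "?L \<longleftrightarrow> ?R") for v
    proof
      assume ?L
      then obtain x w where "\<forall>i<Suc M. w i = (v(M := x)) i" "\<forall>A\<in>set E. holds w A"
        using eq by blast
      then show ?R by (intro exI[of _ w]) (simp add: less_Suc_eq)
    next
      assume ?R
      then obtain w where w: "\<forall>i<M. w i = v i" "\<forall>A\<in>set E. holds w A" by blast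
      then have "\<forall>i<Suc M. w i = (v(M := w M)) i" by (simp add: less_Suc_eq)
      with w(2) show ?L using eq[of v "w M"] by blast
    qed
    with E(1,2) show ?case by (intro exI[of _ E] exI[of _ M']) simp
  qed
  then show thesis using that by blast
qed

section \<open>The Pell equation\<close>

text \<open>The solutions (x_n, y_n) of x^2 - (a^2 - 1) y^2 = 1 for a = c + 1, where a^2 - 1 = c (c
  + 2); using \<open>c\<close> avoids subtraction. The recursion multiplies by the fundamental
  solution (a, 1).\<close>

fun pell_x :: "nat \<Rightarrow> nat \<Rightarrow> nat" and pell_y :: "nat \<Rightarrow> nat \<Rightarrow> nat" where
  "pell_x c 0 = 1"
| "pell_x c (Suc n) = (c + 1) * pell_x c n + c * (c + 2) * pell_y c n"
| "pell_y c 0 = 0"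
| "pell_y c (Suc n) = pell_x c n + (c + 1) * pell_y c n"

lemma pell_norm: "(pell_x c n)\<^sup>2 = 1 + c * (c + 2) * (pell_y c n)\<^sup>2"
proof (induction n)
  case (Suc n)
  have "(pell_x c (Suc n))\<^sup>2 + c * (c + 2) * (1 + c * (c + 2) * (pell_y c n)\<^sup>2) =
      (c + 1)\<^sup>2 * (pell_x c n)\<^sup>2 + c * (c + 2) * (2 * (c + 1) * pell_x c n * pell_y c n)
      + (c * (c + 2))\<^sup>2 * (pell_y c n)\<^sup>2 + c * (c + 2) * (1 + c * (c + 2) * (pell_y c n)\<^sup>2)"
    by (simp add: power2_eq_square algebra_simps)
  also have "\<dots> = 1 + c * (c + 2) * (pell_y c (Suc n))\<^sup>2 + c * (c + 2) * (1 + c * (c + 2) * (pell_y c n)\<^sup>2)"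
    unfolding Suc by (simp add: power2_eq_square algebra_simps, simp add: Suc[unfolded power2_eq_square] algebra_simps)
  finally show ?case by simp
qed simp

lemma pell_add:
  "pell_x c (m + n) = pell_x c m * pell_x c n + c * (c + 2) * (pell_y c m * pell_y c n) \<and>
   pell_y c (m + n) = pell_x c m * pell_y c n + pell_y c m * pell_x c n"
  by (induction n) (simp_all add: algebra_simps)

lemmas pell_x_add = pell_add[THEN conjunct1] and pell_y_add = pell_add[THEN conjunct2]

lemma pell_x_pos: "0 < pell_x c n"
  by (induction n) auto

lemma pell_x_ge_power: "(c + 1) ^ n \<le> pell_x c n"
proof (induction n)
  case (Suc n)
  have "(c + 1) ^ Suc n \<le> (c + 1) * pell_x c n"
    using mult_le_mono2[OF Suc, of "c + 1"] by simp
  then show ?case by simp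
qed simp

lemma strict_mono_pell_y: "strict_mono (pell_y c)"
  by (intro strict_mono_Suc_iff[THEN iffD2] allI) (simp add: pell_x_pos)

lemma le_pell_y: "n \<le> pell_y c n"
  using strict_mono_imp_increasing[OF strict_mono_pell_y] .

lemma pell_x_Suc_ge: "c > 0 \<Longrightarrow> 2 * pell_x c n \<le> pell_x c (Suc n)"
proof -
  assume "c > 0"
  then have "2 * pell_x c n \<le> (c + 1) * pell_x c n" by (intro mult_le_mono1) simp
  also have "\<dots> \<le> pell_x c (Suc n)" by (simp only: pell_x.simps le_add1)
  finally show ?thesis .
qed

lemma strict_mono_pell_x: "c > 0 \<Longrightarrow> strict_mono (pell_x c)"
proof (intro strict_mono_Suc_iff[THEN iffD2] allI)
  fix n assume "c > 0"
  then show "pell_x c n < pell_x c (Suc n)" using pell_x_Suc_ge[of c n] pell_x_pos[of c n] by linarith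
qed

text \<open>Since a = c + 1 is 1 modulo \<open>c\<close>, the recursion degenerates and y_n reveals
  its index.\<close>

lemma pell_cong_index: "[pell_x c n = 1] (mod c) \<and> [pell_y c n = n] (mod c)"
proof (induction n)
  case (Suc n)
  have "[c * pell_x c n + pell_x c n + c * (c + 2) * pell_y c n = 0 + 1 + 0] (mod c)"
    using Suc by (intro cong_add) (simp_all add: cong_0_iff)
  moreover have "[pell_x c n + (c * pell_y c n + pell_y c n) = 1 + (0 + n)] (mod c)"
    using Suc by (intro cong_add) (simp_all add: cong_0_iff)
  ultimately show ?case by (simp add: algebra_simps)
qed simp

text \<open>Both sequences are polynomials in the parameter.\<close>

lemma pell_cong_param:
  assumes "[b = c] (mod m)"
  shows "[pell_x b n = pell_x c n] (mod m) \<and> [pell_y b n = pell_y c n] (mod m)"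
proof (induction n)
  case (Suc n)
  then show ?case unfolding pell_x.simps pell_y.simps using assms
    by (intro conjI cong_add cong_mult cong_refl) simp_all
qed simp

text \<open>The identity x_(m+l) + x_(m-l) = 2 x_m x_l with m = p + l. Either factor on the right
  can serve as a modulus: then reflecting or shifting the index only changes the sign of the
  term.\<close>

lemma pell_x_reflect: "pell_x c (p + 2 * l) + pell_x c p = 2 * pell_x c (p + l) * pell_x c l"
proof -
  have "pell_x c (p + l + l) + pell_x c p = (pell_x c p * pell_x c l + c * (c + 2) * (pell_y c p * pell_y c l)) * pell_x c l
      + c * (c + 2) * ((pell_x c p * pell_y c l + pell_y c p * pell_x c l) * pell_y c l) + pell_x c p"
    unfolding pell_x_add[of c "p + l" l] pell_x_add[of c p l] pell_y_add[of c p l] ..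
  also have "\<dots> = pell_x c p * (1 + c * (c + 2) * (pell_y c l)\<^sup>2) + pell_x c p * (pell_x c l)\<^sup>2
      + 2 * c * (c + 2) * (pell_y c p * pell_y c l * pell_x c l)"
    by (simp add: algebra_simps power2_eq_square)
  also have "\<dots> = 2 * (pell_x c p * pell_x c l + c * (c + 2) * (pell_y c p * pell_y c l)) * pell_x c l"
    unfolding pell_norm[symmetric] by (simp add: algebra_simps power2_eq_square)
  finally show ?thesis unfolding pell_x_add[symmetric] by (simp add: mult_2 add.assoc)
qed

text \<open>An index is folded into 0..n by replacing j with 2 n - j or with j - 2 n. Each move
  keeps x_j up to sign modulo x_n, and j up to sign modulo 2 n.\<close>

lemma pell_x_residue:
  assumes "n > 0"
  shows "\<exists>i\<le>n. (int (pell_x c n) dvd int (pell_x c j) - int (pell_x c i) \<or> int (pell_x c n) dvd int (pell_x c j) + int (pell_x c i)) \<and>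
    (2 * int n dvd int j - int i \<or> 2 * int n dvd int j + int i)"
proof (induction j rule: less_induct)
  case (less j)
  consider "j \<le> n" | "n < j" "j < 2 * n" | "2 * n \<le> j" by linarith
  then show ?case
  proof cases
    case 1
    then show ?thesis by (intro exI[of _ j]) simp
  next
    case 2
    define p where "p = 2 * n - j"
    have "pell_x c (p + 2 * (n - p)) + pell_x c p = 2 * pell_x c (p + (n - p)) * pell_x c (n - p)" by (rule pell_x_reflect)
    moreover have "p + 2 * (n - p) = j" "p + (n - p) = n" "p \<le> n" using 2 by (auto simp: p_def)
    ultimately have "int (pell_x c j) + int (pell_x c p) = int (pell_x c n) * (2 * int (pell_x c (n - p)))"
      by (metis mult.assoc mult.commute of_nat_add of_nat_mult of_nat_numeral)
    moreover have "int j + int p = 2 * int n" using 2 by (simp add: p_def)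
    ultimately show ?thesis using \<open>p \<le> n\<close> by (intro exI[of _ p]) simp
  next
    case 3
    define p where "p = j - 2 * n"
    have j: "j = p + 2 * n" using 3 by (simp add: p_def)
    with assms obtain i where i: "i \<le> n"
      "int (pell_x c n) dvd int (pell_x c p) - int (pell_x c i) \<or> int (pell_x c n) dvd int (pell_x c p) + int (pell_x c i)"
      "2 * int n dvd int p - int i \<or> 2 * int n dvd int p + int i"
      using less[of p] by auto
    have "pell_x c j + pell_x c p = 2 * pell_x c (p + n) * pell_x c n" unfolding j by (rule pell_x_reflect)
    then have *: "int (pell_x c n) dvd int (pell_x c j) + int (pell_x c p)"
      by (metis dvd_triv_right int_dvd_int_iff of_nat_add)
    have "int (pell_x c n) dvd int (pell_x c j) - int (pell_x c i) \<or> int (pell_x c n) dvd int (pell_x c j) + int (pell_x c i)"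
      using i(2)
    proof
      assume "int (pell_x c n) dvd int (pell_x c p) - int (pell_x c i)"
      from dvd_diff[OF * this] show ?thesis by (simp add: algebra_simps)
    next
      assume "int (pell_x c n) dvd int (pell_x c p) + int (pell_x c i)"
      from dvd_diff[OF * this] show ?thesis by (simp add: algebra_simps)
    qed
    moreover have "int j - int i = (int p - int i) + 2 * int n" "int j + int i = (int p + int i) + 2 * int n"
      by (simp_all add: j)
    then have "2 * int n dvd int j - int i \<or> 2 * int n dvd int j + int i"
      using i(3) by (metis dvd_add dvd_refl)
    ultimately show ?thesis using i(1) by blast
  qed
qed

text \<open>For \<open>c > 0\<close> the sequence at least doubles in each step, so x_0, ..., x_n
  are pairwise incongruent modulo x_n even up to sign.\<close>

lemma pell_x_residue_unique:
  assumes "c > 0" "i \<le> n" "j \<le> n"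
    "int (pell_x c n) dvd int (pell_x c j) - int (pell_x c i) \<or> int (pell_x c n) dvd int (pell_x c j) + int (pell_x c i)"
  shows "i = j"
proof -
  have mono: "pell_x c a < pell_x c b \<longleftrightarrow> a < b" "pell_x c a \<le> pell_x c b \<longleftrightarrow> a \<le> b" "pell_x c a = pell_x c b \<longleftrightarrow> a = b" for a b
    using strict_mono_pell_x[OF assms(1)] by (simp_all add: strict_mono_less strict_mono_less_eq strict_mono_eq)
  have le: "pell_x c i \<le> pell_x c n" "pell_x c j \<le> pell_x c n" using assms mono by auto
  show ?thesis using assms(4)
  proof
    assume d: "int (pell_x c n) dvd int (pell_x c j) - int (pell_x c i)"
    have "\<bar>int (pell_x c j) - int (pell_x c i)\<bar> < int (pell_x c n)"
      using le pell_x_pos[of c i] pell_x_pos[of c j] by linarith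
    with d have "int (pell_x c j) - int (pell_x c i) = 0" by (metis dvd_imp_le_int not_le abs_of_nat)
    then show ?thesis using mono by simp
  next
    assume "int (pell_x c n) dvd int (pell_x c j) + int (pell_x c i)"
    then have "pell_x c n dvd pell_x c j + pell_x c i" by (metis int_dvd_int_iff of_nat_add)
    then obtain q where q: "pell_x c j + pell_x c i = pell_x c n * q" by blast
    have "q \<noteq> 0" using q pell_x_pos[of c i] by (cases "q = 0") auto
    show ?thesis
    proof (cases "i = n \<or> j = n")
      case True
      have "q \<noteq> 1" using q True pell_x_pos[of c i] pell_x_pos[of c j] by auto
      with \<open>q \<noteq> 0\<close> have "2 \<le> q" by simp
      then have "pell_x c n * 2 \<le> pell_x c j + pell_x c i" unfolding q by (rule mult_le_mono2)
      with le have "pell_x c j = pell_x c i" by linarith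
      then show ?thesis using mono by simp
    next
      case False
      with assms obtain m where m: "n = Suc m" "i \<le> m" "j \<le> m" by (cases n) auto
      have "pell_x c i \<le> pell_x c m" "pell_x c j \<le> pell_x c m" using m mono by auto
      moreover have "2 * pell_x c m \<le> pell_x c n" unfolding m(1) by (rule pell_x_Suc_ge[OF assms(1)])
      moreover have "pell_x c n \<le> pell_x c j + pell_x c i" using q \<open>q \<noteq> 0\<close> by (cases q) auto
      ultimately have "pell_x c j = pell_x c i" by linarith
      then show ?thesis using mono by simp
    qed
  qed
qed

lemma pell_x_cong_imp_index:
  assumes "c > 0" "n > 0" "i \<le> n" "[pell_x c j = pell_x c i] (mod pell_x c n)"
  shows "2 * int n dvd int j - int i \<or> 2 * int n dvd int j + int i"
proof -
  obtain i' where i': "i' \<le> n"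
    "int (pell_x c n) dvd int (pell_x c j) - int (pell_x c i') \<or> int (pell_x c n) dvd int (pell_x c j) + int (pell_x c i')"
    "2 * int n dvd int j - int i' \<or> 2 * int n dvd int j + int i'"
    using pell_x_residue[OF assms(2)] by blast
  have d: "int (pell_x c n) dvd int (pell_x c j) - int (pell_x c i)"
    using assms(4) by (metis cong_iff_dvd_diff cong_int_iff)
  have "int (pell_x c n) dvd int (pell_x c i) - int (pell_x c i') \<or> int (pell_x c n) dvd int (pell_x c i) + int (pell_x c i')"
    using i'(2)
  proof
    assume "int (pell_x c n) dvd int (pell_x c j) - int (pell_x c i')"
    from dvd_diff[OF this d] show ?thesis by simp
  next
    assume "int (pell_x c n) dvd int (pell_x c j) + int (pell_x c i')"
    from dvd_diff[OF this d] show ?thesis by (simp add: algebra_simps)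
  qed
  from pell_x_residue_unique[OF assms(1) i'(1) assms(3) this] i'(3) show ?thesis by simp
qed

text \<open>Descent: multiplying by the inverse (a, -1) of the fundamental solution gives a solution
  (x', y'). For y > 0 the bounds c y < x and x <= (c + 1) y yield y' < y and keep y'
  nonnegative.\<close>

lemma pell_complete:
  assumes "c > 0" "x\<^sup>2 = 1 + c * (c + 2) * y\<^sup>2"
  obtains n where "x = pell_x c n" "y = pell_y c n"
proof -
  have "\<exists>n. x = pell_x c n \<and> y = pell_y c n"
    using assms(2)
  proof (induction y arbitrary: x rule: less_induct)
    case (less y)
    show ?case
    proof (cases "y = 0")
      case True
      then show ?thesis using less.prems by (intro exI[of _ 0]) simp
    next
      case False
      then have y: "1 \<le> y\<^sup>2" by simp
      have "x\<^sup>2 \<le> ((c + 1) * y)\<^sup>2"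
        unfolding less.prems using y by (simp add: power2_eq_square algebra_simps)
      then have "x \<le> (c + 1) * y" by (rule power2_le_imp_le) simp
      then obtain y' where y': "(c + 1) * y = x + y'" using le_Suc_ex by blast
      have "(c * y)\<^sup>2 < x\<^sup>2"
        unfolding less.prems by (simp add: power2_eq_square algebra_simps)
      then have "c * y < x" by (rule power_less_imp_less_base) simp
      with y' have "y' < y" by simp
      have "(c * (c + 2) * y)\<^sup>2 = c * (c + 2) * (c * (c + 2) * y\<^sup>2)"
        by (simp add: power2_eq_square algebra_simps)
      also have "\<dots> \<le> c * (c + 2) * x\<^sup>2" unfolding less.prems by (intro mult_le_mono2) simp
      also have "\<dots> \<le> ((c + 1) * x)\<^sup>2" by (simp add: power2_eq_square algebra_simps)
      finally have "c * (c + 2) * y \<le> (c + 1) * x" by (rule power2_le_imp_le) simp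
      then obtain x' where x': "(c + 1) * x = c * (c + 2) * y + x'" using le_Suc_ex by blast
      define C X Y where "C = int c" and "X = int x" and "Y = int y"
      have ix: "int x' = (C + 1) * X - C * (C + 2) * Y"
        using arg_cong[OF x', of int] by (simp add: C_def X_def Y_def algebra_simps)
      have iy: "int y' = (C + 1) * Y - X"
        using arg_cong[OF y', of int] by (simp add: C_def X_def Y_def algebra_simps)
      have n: "X\<^sup>2 = 1 + C * (C + 2) * Y\<^sup>2"
        using arg_cong[OF less.prems, of int] by (simp add: C_def X_def Y_def algebra_simps)
      have "(int x')\<^sup>2 = 1 + C * (C + 2) * (int y')\<^sup>2"
      proof -
        have "(int x')\<^sup>2 - C * (C + 2) * (int y')\<^sup>2 = X\<^sup>2 - C * (C + 2) * Y\<^sup>2"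
          unfolding ix iy by (simp add: power2_eq_square algebra_simps)
        with n show ?thesis by simp
      qed
      then have "int (x'\<^sup>2) = int (1 + c * (c + 2) * y'\<^sup>2)"
        unfolding C_def by (simp add: algebra_simps)
      then have "x'\<^sup>2 = 1 + c * (c + 2) * y'\<^sup>2" by (rule of_nat_eq_iff[THEN iffD1])
      from less.IH[OF \<open>y' < y\<close> this] obtain n where n: "x' = pell_x c n" "y' = pell_y c n" by blast
      have "X = (C + 1) * int x' + C * (C + 2) * int y'" "Y = int x' + (C + 1) * int y'"
        unfolding ix iy by (simp_all add: algebra_simps)
      then have "int x = int (pell_x c (Suc n))" "int y = int (pell_y c (Suc n))"
        unfolding n X_def Y_def C_def by (simp_all add: algebra_simps)
      then have "x = pell_x c (Suc n)" "y = pell_y c (Suc n)" by (simp_all only: of_nat_eq_iff)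
      then show ?thesis by blast
    qed
  qed
  then show thesis using that by blast
qed

section \<open>Divisibility among the Pell numbers\<close>

lemma coprime_pell_x_pell_y: "coprime (pell_x c n) (pell_y c n)"
proof (rule coprimeI)
  fix d assume "d dvd pell_x c n" "d dvd pell_y c n"
  then have "d dvd (pell_x c n)\<^sup>2" "d dvd c * (c + 2) * (pell_y c n)\<^sup>2" by (simp_all add: power2_eq_square)
  then show "is_unit d" unfolding pell_norm by (metis dvd_add_left_iff)
qed

lemma pell_y_dvd_pell_y_mult: "pell_y c n dvd pell_y c (n * k)"
  by (induction k) (simp_all add: pell_y_add add.commute)

text \<open>Write m = n k + r with r < n. The addition formula leaves y_n dividing x_(n k) y_r; y_n
  is coprime to the first factor and larger than y_r, so r = 0.\<close>

lemma pell_y_dvd_imp_dvd: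
  assumes "c > 0" "n > 0" "pell_y c n dvd pell_y c m"
  shows "n dvd m"
proof -
  define k r where "k = m div n" and "r = m mod n"
  have "m = n * k + r" "r < n" using assms(2) by (simp_all add: k_def r_def)
  have "pell_y c n dvd pell_x c (n * k) * pell_y c r + pell_y c (n * k) * pell_x c r"
    using assms(3) unfolding \<open>m = n * k + r\<close> pell_y_add .
  then have "pell_y c n dvd pell_x c (n * k) * pell_y c r"
    by (metis dvd_add_left_iff dvd_mult2 pell_y_dvd_pell_y_mult)
  moreover have "coprime (pell_y c n) (pell_x c (n * k))"
    using coprime_pell_x_pell_y[of c "n * k"] pell_y_dvd_pell_y_mult[of c n k] by (metis coprime_commute coprime_divisors dvd_refl)
  ultimately have "pell_y c n dvd pell_y c r" by (simp add: coprime_dvd_mult_right_iff)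
  moreover have "pell_y c r < pell_y c n" using \<open>r < n\<close> strict_mono_pell_y by (simp add: strict_mono_less)
  ultimately have "pell_y c r = 0" by (meson nat_dvd_not_less not_gr_zero)
  then have "r = 0" using le_pell_y[of r c] by simp
  then show ?thesis using \<open>m = n * k + r\<close> by simp
qed

text \<open>The first terms of the binomial expansion of (x_n + y_n sqrt(a^2 - 1))^k. The extra
  factor x_n in the second congruence avoids the exponent k - 1.\<close>

lemma pell_y_mult_cong:
  "[pell_x c (n * k) = pell_x c n ^ k] (mod (pell_y c n)\<^sup>2) \<and>
   [pell_y c (n * k) * pell_x c n = k * pell_x c n ^ k * pell_y c n] (mod (pell_y c n)\<^sup>2)"
proof (induction k)
  case (Suc k)
  let ?x = "pell_x c n" and ?y = "pell_y c n"
  have e: "n * Suc k = n * k + n" by simp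
  have "?y\<^sup>2 dvd c * (c + 2) * (pell_y c (n * k) * ?y)"
    unfolding power2_eq_square by (intro dvd_mult mult_dvd_mono pell_y_dvd_pell_y_mult dvd_refl)
  then have "[pell_x c (n * k) * ?x + c * (c + 2) * (pell_y c (n * k) * ?y) = ?x ^ k * ?x + 0] (mod ?y\<^sup>2)"
    using Suc by (intro cong_add cong_mult) (simp_all add: cong_0_iff)
  moreover have "[(pell_y c (n * k) * ?x) * ?x + pell_x c (n * k) * (?x * ?y) =
      k * ?x ^ k * ?y * ?x + ?x ^ k * (?x * ?y)] (mod ?y\<^sup>2)"
    by (intro Suc[THEN conjunct2] Suc[THEN conjunct1] cong_add cong_scalar_right)
  ultimately show ?case unfolding e pell_x_add pell_y_add by (simp add: algebra_simps)
qed simp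

lemma pell_y_square_dvd_pell_y_mult: "(pell_y c n)\<^sup>2 dvd pell_y c (n * pell_y c n)"
proof -
  have "(pell_y c n)\<^sup>2 dvd pell_y c n * pell_x c n ^ pell_y c n * pell_y c n" by (simp add: power2_eq_square)
  then have "(pell_y c n)\<^sup>2 dvd pell_y c (n * pell_y c n) * pell_x c n"
    using cong_dvd_iff[OF conjunct2[OF pell_y_mult_cong[of c n "pell_y c n"]]] by simp
  moreover have "coprime ((pell_y c n)\<^sup>2) (pell_x c n)" using coprime_pell_x_pell_y[of c n] by (simp add: coprime_commute)
  ultimately show ?thesis by (simp add: coprime_dvd_mult_left_iff)
qed

text \<open>Once m = n k is known, the expansion modulo y_n^2 shows that y_n divides k x_n^k, and
  coprimality leaves k. This bounds an index from below by a value of the sequence.\<close>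

lemma pell_y_square_dvd_imp_dvd:
  assumes "c > 0" "n > 0" "(pell_y c n)\<^sup>2 dvd pell_y c m"
  shows "pell_y c n dvd m" "n dvd m"
proof -
  have "pell_y c n dvd pell_y c m" using assms(3) by (metis dvd_mult_left power2_eq_square)
  then show "n dvd m" by (rule pell_y_dvd_imp_dvd[OF assms(1,2)])
  then obtain k where k: "m = n * k" by blast
  have "(pell_y c n)\<^sup>2 dvd pell_y c (n * k) * pell_x c n" using assms(3) k by simp
  then have "(pell_y c n)\<^sup>2 dvd k * pell_x c n ^ k * pell_y c n"
    using cong_dvd_iff[OF conjunct2[OF pell_y_mult_cong[of c n k]]] by simp
  moreover have "pell_y c n > 0" using le_pell_y[of n c] assms(2) by simp
  ultimately have "pell_y c n dvd k * pell_x c n ^ k" by (simp add: power2_eq_square)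
  moreover have "coprime (pell_y c n) (pell_x c n ^ k)" using coprime_pell_x_pell_y[of c n] by (simp add: coprime_commute)
  ultimately have "pell_y c n dvd k" by (simp add: coprime_dvd_mult_left_iff)
  then show "pell_y c n dvd m" using k by simp
qed

text \<open>Let i, n, j be the indices of the solutions (x, y), (u, v), (s, t), the last one for the
  parameter \<open>b\<close>. Divisibility of v by y^2 makes n a multiple of y. Modulo u the
  parameters agree, so j is i up to sign modulo 2 n, hence modulo 2 y. As 2 y divides
  \<open>b\<close>, t reveals j modulo 2 y, which ties j to \<open>k\<close>.\<close>

lemma pell_characterization:
  assumes c: "c > 0" and k: "k > 0"
  shows "x = pell_x c k \<and> y = pell_y c k \<longleftrightarrow> x\<^sup>2 = 1 + c * (c + 2) * y\<^sup>2 \<and> k \<le> y \<and>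
    (\<exists>u v s t b. u\<^sup>2 = 1 + c * (c + 2) * v\<^sup>2 \<and> 0 < v \<and> y\<^sup>2 dvd v \<and>
      s\<^sup>2 = 1 + b * (b + 2) * t\<^sup>2 \<and> 0 < b \<and> [b = c] (mod u) \<and> 2 * y dvd b \<and>
      [s = x] (mod u) \<and> [t = k] (mod 2 * y))" (is "?L \<longleftrightarrow> ?R")
proof
  assume ?L
  then have x: "x = pell_x c k" and y: "y = pell_y c k" by auto
  have "k \<le> y" unfolding y by (rule le_pell_y)
  with k have "y > 0" by simp
  \<comment> \<open>The factor y in the index makes y^2 divide v, and doubling the index makes v
    even. Hence u is coprime to 2 y, as the Chinese remainder theorem requires.\<close>
  define m where "m = k * y"
  define u v where "u = pell_x c (2 * m)" and "v = pell_y c (2 * m)"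
  have uv: "u\<^sup>2 = 1 + c * (c + 2) * v\<^sup>2" unfolding u_def v_def by (rule pell_norm)
  have "v = 2 * (pell_x c m * pell_y c m)" unfolding v_def mult_2 pell_y_add by simp
  moreover have "y\<^sup>2 dvd pell_y c m" unfolding y m_def by (rule pell_y_square_dvd_pell_y_mult)
  ultimately have "y\<^sup>2 dvd v" "2 dvd v" by simp_all
  have "0 < 2 * m" using k \<open>y > 0\<close> by (simp add: m_def)
  with le_pell_y[of "2 * m" c] have "0 < v" unfolding v_def by linarith
  have "coprime u v" unfolding u_def v_def by (rule coprime_pell_x_pell_y)
  then have "coprime u (2::nat)" "coprime u y"
    using \<open>2 dvd v\<close> \<open>y\<^sup>2 dvd v\<close> by (metis coprime_divisors dvd_refl, metis coprime_divisors dvd_refl dvd_trans dvd_triv_left power2_eq_square)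
  then have "coprime u (2 * y)" by simp
  then obtain b0 where b0: "[b0 = c] (mod u)" "[b0 = 0] (mod 2 * y)"
    using binary_chinese_remainder_nat by blast
  \<comment> \<open>Adding a common multiple of both moduli makes \<open>b\<close> positive.\<close>
  define b where "b = b0 + 2 * y * u"
  have "[b = c] (mod u)" using b0(1) by (simp add: b_def cong_def)
  moreover have "2 * y dvd b" using b0(2) by (simp add: b_def cong_0_iff)
  moreover have "0 < b" using \<open>y > 0\<close> by (simp add: b_def u_def pell_x_pos)
  moreover have "[pell_x b k = x] (mod u)" unfolding x using pell_cong_param[OF \<open>[b = c] (mod u)\<close>] by blast
  moreover have "[pell_y b k = k] (mod 2 * y)"
    using cong_dvd_modulus_nat[OF conjunct2[OF pell_cong_index[of b k]] \<open>2 * y dvd b\<close>] .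
  ultimately show ?R
    using uv \<open>0 < v\<close> \<open>y\<^sup>2 dvd v\<close> \<open>k \<le> y\<close> pell_norm[of c k] pell_norm[of b k] unfolding x y by blast
next
  assume ?R
  then obtain u v s t b where xy: "x\<^sup>2 = 1 + c * (c + 2) * y\<^sup>2" "k \<le> y"
    and uv: "u\<^sup>2 = 1 + c * (c + 2) * v\<^sup>2" "0 < v" "y\<^sup>2 dvd v"
    and st: "s\<^sup>2 = 1 + b * (b + 2) * t\<^sup>2" "0 < b"
    and cg: "[b = c] (mod u)" "2 * y dvd b" "[s = x] (mod u)" "[t = k] (mod 2 * y)"
    by blast
  obtain i where i: "x = pell_x c i" "y = pell_y c i" using pell_complete[OF c xy(1)] .
  obtain n where n: "u = pell_x c n" "v = pell_y c n" using pell_complete[OF c uv(1)] .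
  obtain j where j: "s = pell_x b j" "t = pell_y b j" using pell_complete[OF st(2,1)] .
  have "i > 0" using i(2) xy(2) k by (cases i) auto
  have "n > 0" using n(2) uv(2) by (cases n) auto
  have "y dvd n" "i dvd n" using pell_y_square_dvd_imp_dvd[OF c \<open>i > 0\<close>] uv(3) unfolding i n by auto
  have "i \<le> n" using \<open>i dvd n\<close> \<open>n > 0\<close> by (rule dvd_imp_le)
  have "[pell_x c j = pell_x c i] (mod pell_x c n)"
    using pell_cong_param[OF cg(1), of j] cg(3) unfolding i n j by (metis cong_sym cong_trans)
  from pell_x_cong_imp_index[OF c \<open>n > 0\<close> \<open>i \<le> n\<close> this]
  have *: "2 * int n dvd int j - int i \<or> 2 * int n dvd int j + int i" .
  have "2 * int y dvd 2 * int n" using \<open>y dvd n\<close> by simp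
  with * have **: "2 * int y dvd int j - int i \<or> 2 * int y dvd int j + int i" by (meson dvd_trans)
  have "[j = k] (mod 2 * y)"
    using cong_dvd_modulus_nat[OF conjunct2[OF pell_cong_index[of b j]] cg(2)] cg(4) unfolding j
    by (metis cong_sym cong_trans)
  then have jk: "2 * int y dvd int j - int k"
    by (metis cong_iff_dvd_diff cong_int_iff of_nat_mult of_nat_numeral)
  have "2 * int y dvd int k - int i \<or> 2 * int y dvd int k + int i"
    using **
  proof
    assume "2 * int y dvd int j - int i"
    from dvd_diff[OF this jk] show ?thesis by simp
  next
    assume "2 * int y dvd int j + int i"
    from dvd_diff[OF this jk] show ?thesis by (simp add: algebra_simps)
  qed
  \<comment> \<open>Both \<open>k\<close> and \<open>i\<close> lie between 1 and y: either their
    difference vanishes, or their sum is 2 y and both equal y.\<close>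
  moreover have "i \<le> y" unfolding i(2) by (rule le_pell_y)
  ultimately have "k = i"
  proof (elim disjE)
    assume d: "2 * int y dvd int k - int i"
    have "\<bar>int k - int i\<bar> < 2 * int y" using \<open>i \<le> y\<close> xy(2) k \<open>i > 0\<close> by linarith
    then show ?thesis using d by (metis abs_of_nat abs_mult abs_numeral dvd_imp_le_int eq_iff_diff_eq_0 not_le of_nat_eq_iff)
  next
    assume "2 * int y dvd int k + int i"
    then have "2 * int y \<le> int k + int i" using k by (intro zdvd_imp_le) auto
    then show ?thesis using \<open>i \<le> y\<close> xy(2) by linarith
  qed
  then show ?L using i by simp
qed

text \<open>Modulo t = 2 a n - n^2 - 1, the number n - a is a square root of a^2 - 1. Hence x_k +
  y_k sqrt(a^2 - 1), the k-th power of a + sqrt(a^2 - 1), becomes n^k.\<close>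

lemma pell_x_power_cong:
  assumes "t + n\<^sup>2 + 1 = 2 * (c + 1) * n"
  shows "[pell_x c k + n * pell_y c k = n ^ k + (c + 1) * pell_y c k] (mod t)"
proof -
  define C N where "C = int c + 1" and "N = int n"
  have t: "int t = 2 * C * N - N\<^sup>2 - 1"
    using arg_cong[OF assms, of int] by (simp add: C_def N_def algebra_simps)
  have "int t dvd (int (pell_x c k) + N * int (pell_y c k)) - (N ^ k + C * int (pell_y c k))"
  proof (induction k)
    case (Suc k)
    define X Y where "X = int (pell_x c k)" and "Y = int (pell_y c k)"
    have "(int (pell_x c (Suc k)) + N * int (pell_y c (Suc k))) - (N ^ Suc k + C * int (pell_y c (Suc k))) =
      N * ((X + N * Y) - (N ^ k + C * Y)) + int t * Y"
      unfolding t by (simp add: X_def Y_def C_def algebra_simps power2_eq_square)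
    with Suc show ?case by (simp add: X_def Y_def)
  qed simp
  then have "[int (pell_x c k + n * pell_y c k) = int (n ^ k + (c + 1) * pell_y c k)] (mod int t)"
    by (simp add: cong_iff_dvd_diff N_def C_def algebra_simps)
  then show ?thesis by (simp only: cong_int_iff)
qed

text \<open>The congruence determines the power as soon as \<open>t\<close> exceeds it. A large
  enough parameter \<open>c\<close> comes from another Pell number \<open>X\<close>, which dominates
  the power by its exponential growth.\<close>

lemma power_characterization:
  fixes n k m :: nat
  assumes X: "X = pell_x (n + 2) (Suc k)" and c: "c = X + n"
    and t: "t + (Suc n)\<^sup>2 + 1 = 2 * (c + 1) * Suc n"
  shows "m = Suc n ^ Suc k \<longleftrightarrow>
    m < t \<and> [pell_x c (Suc k) + Suc n * pell_y c (Suc k) = m + (c + 1) * pell_y c (Suc k)] (mod t)"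
proof -
  have "Suc n ^ Suc k < (n + 2 + 1) ^ Suc k" by (intro power_strict_mono) auto
  also have "\<dots> \<le> X" unfolding X by (rule pell_x_ge_power)
  also have "X \<le> t" using t unfolding c by (simp add: algebra_simps power2_eq_square)
  finally have lt: "Suc n ^ Suc k < t" .
  have cg: "[pell_x c (Suc k) + Suc n * pell_y c (Suc k) = Suc n ^ Suc k + (c + 1) * pell_y c (Suc k)] (mod t)"
    by (rule pell_x_power_cong[OF t])
  show ?thesis
  proof
    assume "m < t \<and> [pell_x c (Suc k) + Suc n * pell_y c (Suc k) = m + (c + 1) * pell_y c (Suc k)] (mod t)"
    then have "m < t" "[m = Suc n ^ Suc k] (mod t)"
      using cg by (blast, meson cong_add_rcancel_nat cong_sym cong_trans)
    then show "m = Suc n ^ Suc k" using lt by (simp add: cong_def)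
  qed (use lt cg in auto)
qed

section \<open>Exponentiation, binomial coefficients and factorials\<close>

lemma dioph_pell[dioph_intros]:
  assumes "dfun f" "dfun g" "dfun h" "dfun l"
  shows "dioph (\<lambda>v. h v = pell_x (Suc (f v)) (Suc (g v)) \<and> l v = pell_y (Suc (f v)) (Suc (g v)))"
  unfolding pell_characterization[OF zero_less_Suc zero_less_Suc] power2_eq_square
  by (intro dioph_intros assms assms[THEN dfun_rename])

lemma dfun_Suc_power_Suc:
  assumes "dfun f" "dfun g"
  shows "dfun (\<lambda>v. Suc (f v) ^ Suc (g v))"
proof -
  have eq: "m = Suc n ^ Suc k \<longleftrightarrow> (\<exists>X Y d t x y. (X = pell_x (Suc (Suc n)) (Suc k) \<and> Y = pell_y (Suc (Suc n)) (Suc k)) \<and>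
     X + n = Suc d \<and> t + Suc n * Suc n + 1 = 2 * (Suc d + 1) * Suc n \<and>
     (x = pell_x (Suc d) (Suc k) \<and> y = pell_y (Suc d) (Suc k)) \<and>
     m < t \<and> [x + Suc n * y = m + (Suc d + 1) * y] (mod t))" (is "_ \<longleftrightarrow> ?R") for m n k
  proof -
    define X where "X = pell_x (n + 2) (Suc k)"
    have "X > 0" unfolding X_def by (rule pell_x_pos)
    then obtain d where d: "X + n = Suc d" by (cases "X + n") auto
    have "Suc n * Suc n + 1 \<le> 2 * (Suc d + 1) * Suc n"
      unfolding d[symmetric] using \<open>X > 0\<close> by (simp add: algebra_simps)
    then obtain t where t: "t + Suc n * Suc n + 1 = 2 * (Suc d + 1) * Suc n"
      by (metis add.assoc add.commute le_Suc_ex)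
    have char: "m = Suc n ^ Suc k \<longleftrightarrow> m < t' \<and>
        [pell_x (Suc d) (Suc k) + Suc n * pell_y (Suc d) (Suc k) = m + (Suc d + 1) * pell_y (Suc d) (Suc k)] (mod t')"
      if "t' + Suc n * Suc n + 1 = 2 * (Suc d + 1) * Suc n" for t'
      by (rule power_characterization[OF X_def d[symmetric]]) (use that in \<open>simp only: power2_eq_square\<close>)
    have X': "pell_x (Suc (Suc n)) (Suc k) = X" by (simp only: X_def add_2_eq_Suc')
    show ?thesis
    proof
      assume "m = Suc n ^ Suc k"
      with char[OF t] have "m < t \<and> [pell_x (Suc d) (Suc k) + Suc n * pell_y (Suc d) (Suc k) =
        m + (Suc d + 1) * pell_y (Suc d) (Suc k)] (mod t)" by blast
      then show ?R
        using X' d t by (intro exI[of _ X] exI[of _ d] exI[of _ t] exI conjI) (assumption | rule refl | simp only:)+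
    next
      assume ?R
      then obtain d' t' where "X + n = Suc d'" "t' + Suc n * Suc n + 1 = 2 * (Suc d' + 1) * Suc n"
        "m < t'" "[pell_x (Suc d') (Suc k) + Suc n * pell_y (Suc d') (Suc k) = m + (Suc d' + 1) * pell_y (Suc d') (Suc k)] (mod t')"
        unfolding X' by blast
      moreover from this(1) have "d' = d" using d by simp
      ultimately show "m = Suc n ^ Suc k" using char by blast
    qed
  qed
  show ?thesis unfolding dfun_def eq by (intro dioph_intros assms assms(1,2)[THEN dfun_rename])
qed

lemma dfun_power[dioph_intros]:
  assumes "dfun f" "dfun g" "\<And>v. f v > 0"
  shows "dfun (\<lambda>v. f v ^ g v)"
proof -
  \<comment> \<open>Dividing by the base once more admits the exponent 0.\<close>
  have "z = a ^ b \<longleftrightarrow> (\<exists>p. a = Suc p \<and> z = Suc p ^ Suc b div Suc p)" if "a > 0" for z a b :: nat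
    using that by (cases a) (auto simp del: mult_Suc mult_Suc_right simp: nonzero_mult_div_cancel_left)
  then have eq: "z = f v ^ b \<longleftrightarrow> (\<exists>p. f v = Suc p \<and> z = Suc p ^ Suc b div Suc p)" for z v b
    using assms(3) by blast
  show ?thesis unfolding dfun_def eq by (intro dioph_intros dfun_Suc_power_Suc assms assms(1,2)[THEN dfun_rename]) simp
qed

lemma sum_digits_div_mod:
  fixes d :: "nat \<Rightarrow> nat"
  assumes "\<And>i. d i < B"
  shows "(\<Sum>i<n. d i * B ^ i) div B ^ k mod B = (if k < n then d k else 0)"
  using assms
proof (induction k arbitrary: d n)
  case 0
  show ?case
  proof (cases n)
    case (Suc m)
    have "(\<Sum>i<n. d i * B ^ i) = d 0 + (\<Sum>i<m. d (Suc i) * B ^ i) * B"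
      unfolding Suc sum.lessThan_Suc_shift by (simp add: sum_distrib_left sum_distrib_right mult_ac)
    with 0[of 0] Suc show ?thesis by simp
  qed simp
next
  case (Suc k)
  show ?case
  proof (cases n)
    case (Suc m)
    have "(\<Sum>i<n. d i * B ^ i) = d 0 + (\<Sum>i<m. d (Suc i) * B ^ i) * B"
      unfolding Suc sum.lessThan_Suc_shift by (simp add: sum_distrib_left sum_distrib_right mult_ac)
    then have "(\<Sum>i<n. d i * B ^ i) div B = (\<Sum>i<m. d (Suc i) * B ^ i)"
      using Suc.prems[of 0] by simp
    then show ?thesis
      using Suc.IH[of "\<lambda>i. d (Suc i)" m] Suc.prems Suc by (simp add: div_mult2_eq)
  qed simp
qed

text \<open>In base B = 2^n + 1, which exceeds all the coefficients, the digits of (B + 1)^n are the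
  binomial coefficients.\<close>

lemma binomial_digit:
  "n choose k = Suc (Suc (2 ^ n)) ^ n div Suc (2 ^ n) ^ k mod Suc (2 ^ n)"
proof -
  let ?B = "Suc (2 ^ n) :: nat"
  have "(1 + ?B) ^ n = (\<Sum>i\<le>n. (n choose i) * ?B ^ i)"
    unfolding binomial[of ?B 1 n, unfolded add.commute[of _ 1]] by simp
  then have "Suc ?B ^ n = (\<Sum>i<Suc n. (n choose i) * ?B ^ i)"
    by (simp only: lessThan_Suc_atMost plus_1_eq_Suc)
  moreover have "n choose i < ?B" for i
    by (cases "i \<le> n") (simp_all add: binomial_le_pow2 less_Suc_eq_le)
  ultimately show ?thesis
    using sum_digits_div_mod[of "\<lambda>i. n choose i" ?B "Suc n" k] by simp
qed

lemma dfun_binomial[dioph_intros]: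
  assumes "dfun f" "dfun g" shows "dfun (\<lambda>v. f v choose g v)"
  unfolding binomial_digit by (intro dioph_intros assms assms(1,2)[THEN dfun_rename]) simp_all

section \<open>Factorials as quotients of powers and binomial coefficients\<close>

lemma binomial_Suc_fact: "(r choose Suc n) * fact (Suc n) = (r choose n) * fact n * (r - n)"
proof -
  have "Suc n * (r choose Suc n) = (r - n) * (r choose n)"
    unfolding binomial_absorb_comp binomial_absorption ..
  then have "fact n * (Suc n * (r choose Suc n)) = fact n * ((r - n) * (r choose n))" by simp
  then show ?thesis by (simp add: algebra_simps)
qed

lemma fact_binomial_le: "(r choose n) * fact n \<le> r ^ n"
proof (induction n)
  case (Suc n)
  have "(r choose n) * fact n * (r - n) \<le> r ^ n * r" by (intro mult_le_mono Suc) simp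
  then show ?case unfolding binomial_Suc_fact by (simp add: algebra_simps)
qed simp

text \<open>Estimates how far the falling factorial stays below \<open>r ^ n\<close>; multiplying by
  \<open>r\<close> avoids the exponent \<open>n - 1\<close>.\<close>

lemma power_le_fact_binomial: "r ^ Suc n \<le> r * ((r choose n) * fact n) + n\<^sup>2 * r ^ n"
proof (induction n)
  case (Suc n)
  let ?P = "(r choose n) * fact n"
  have "r * (r * ?P) \<le> r * ((r choose Suc n) * fact (Suc n)) + n * r * ?P"
  proof -
    have "r * (r * ?P) \<le> r * (((r - n) + n) * ?P)" by (intro mult_le_mono) auto
    then show ?thesis unfolding binomial_Suc_fact by (simp only: algebra_simps)
  qed
  moreover have "n * r * ?P \<le> n * r * r ^ n" by (intro mult_le_mono2 fact_binomial_le)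
  moreover have "r ^ Suc (Suc n) \<le> r * (r * ?P) + r * (n\<^sup>2 * r ^ n)"
    using mult_le_mono2[OF Suc, of r] by (simp add: distrib_left)
  moreover have "(n + n\<^sup>2) * r ^ Suc n = n * r * r ^ n + r * (n\<^sup>2 * r ^ n)"
    by (simp add: algebra_simps)
  ultimately have "r ^ Suc (Suc n) \<le> r * ((r choose Suc n) * fact (Suc n)) + (n + n\<^sup>2) * r ^ Suc n"
    by linarith
  also have "(n + n\<^sup>2) * r ^ Suc n \<le> (Suc n)\<^sup>2 * r ^ Suc n"
    by (intro mult_le_mono1) (simp add: power2_eq_square)
  finally show ?case by simp
qed simp

text \<open>The quotient of \<open>r ^ n\<close> by \<open>r choose n\<close> tends to
  \<open>fact n\<close> from above as \<open>r\<close> grows; for \<open>r\<close> this large the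
  excess is below 1.\<close>

lemma fact_eq_div:
  assumes r: "r > n\<^sup>2 * (fact n + 1)"
  shows "fact n = r ^ n div (r choose n)"
proof -
  define F P D where "F = (fact n :: nat)" and "P = (r choose n) * fact n" and "D = r ^ n - P"
  have D: "r ^ n = P + D" using fact_binomial_le[of r n] by (simp add: D_def P_def)
  have "r * D \<le> n\<^sup>2 * r ^ n"
    using power_le_fact_binomial[of r n] D unfolding P_def[symmetric] by (simp add: algebra_simps)
  then have "r * ((F + 1) * D) \<le> (n\<^sup>2 * (F + 1)) * r ^ n"
    using mult_le_mono2[of "r * D" "n\<^sup>2 * r ^ n" "F + 1"] by (simp add: algebra_simps)
  also have "\<dots> < r * r ^ n" using r unfolding F_def by (intro mult_strict_right_mono) auto
  finally have "(F + 1) * D < r ^ n" by simp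
  then have "F * D < P" unfolding D by simp
  then have "D < r choose n" unfolding P_def F_def by (metis mult.commute mult_less_cancel2 fact_gt_zero)
  moreover from this have "0 < r choose n" by (rule le_less_trans[OF le0])
  ultimately show ?thesis unfolding D P_def by simp
qed

lemma dfun_fact[dioph_intros]:
  assumes "dfun f" shows "dfun (\<lambda>v. fact (f v))"
proof -
  \<comment> \<open>\<open>Suc n ^ n\<close> replaces the factorial that it bounds, so that
    \<open>r\<close> is defined by powers alone.\<close>
  define r where "r n = Suc (n * n * (Suc n ^ n + 1))" for n :: nat
  have "fact n \<le> Suc n ^ n" for n :: nat
  proof -
    have "(fact n :: nat) \<le> n ^ n" using fact_le_power[of n, where 'a = nat] by simp
    also have "\<dots> \<le> Suc n ^ n" by (intro power_mono) auto
    finally show ?thesis .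
  qed
  then have "n\<^sup>2 * (fact n + 1) < r n" for n
    unfolding r_def power2_eq_square by (simp add: less_Suc_eq_le)
  then have eq: "fact n = r n ^ n div (r n choose n)" for n by (rule fact_eq_div)
  have pos: "0 < r n choose n" for n
    by (rule zero_less_binomial) (cases n; simp add: r_def)
  show ?thesis unfolding eq
    using pos unfolding r_def by (intro dioph_intros assms assms[THEN dfun_rename]) simp_all
qed

section \<open>Bounded universal quantification\<close>

lemma dioph_ball_list:
  assumes "\<And>x. x \<in> set xs \<Longrightarrow> dioph (P x)"
  shows "dioph (\<lambda>v. \<forall>x\<in>set xs. P x v)"
  using assms by (induction xs) (auto intro: dioph_intros)

lemma dioph_all_less:
  fixes n :: nat
  assumes "\<And>i. i < n \<Longrightarrow> dioph (P i)"
  shows "dioph (\<lambda>v. \<forall>i<n. P i v)"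
  using dioph_ball_list[of "[0..<n]" P] assms by (simp add: Ball_def)

lemma prod_diff_eq_binomial_fact: "(\<Prod>j<k. N - j) = (N choose k) * fact k"
proof (induction k)
  case (Suc k)
  then show ?case unfolding binomial_Suc_fact by simp
qed simp

lemma prod_add_eq_binomial_fact: "(\<Prod>j=1..n. q + j) = ((q + n) choose n) * fact n"
proof (induction n)
  case (Suc n)
  have "(q + Suc n) * ((q + n) choose n) = ((q + Suc n) choose Suc n) * Suc n"
    using Suc_times_binomial_eq[of "q + n" n] by simp
  then have "(q + Suc n) * ((q + n) choose n) * fact n = ((q + Suc n) choose Suc n) * Suc n * fact n"
    by simp
  with Suc show ?case by (simp add: mult_ac del: binomial_Suc_Suc mult_Suc mult_Suc_right)
qed simp

lemma coprime_natI:
  fixes a b :: nat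
  assumes "\<And>p. prime p \<Longrightarrow> p dvd a \<Longrightarrow> p dvd b \<Longrightarrow> False"
  shows "coprime a b"
proof (rule ccontr)
  assume "\<not> coprime a b"
  then have "gcd a b \<noteq> 1" using coprime_iff_gcd_eq_1 by blast
  then obtain p where "prime p" "p dvd gcd a b" using prime_factor_nat by blast
  then show False using assms[of p] by simp
qed

fun mod_holds :: "nat \<Rightarrow> (nat \<Rightarrow> nat) \<Rightarrow> atom \<Rightarrow> bool" where
  "mod_holds m a (Add i j k) \<longleftrightarrow> [a i + a j = a k] (mod m)"
| "mod_holds m a (Mul i j k) \<longleftrightarrow> [a i * a j = a k] (mod m)"
| "mod_holds m a (One i) \<longleftrightarrow> [a i = 1] (mod m)"

lemma dioph_mod_holds: "dfun f \<Longrightarrow> dioph (\<lambda>v. mod_holds (f v) (\<lambda>i. v (\<rho> i)) A)"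
  by (cases A) (auto intro!: dioph_intros)

lemma mod_holds_dvd: "mod_holds m a A \<Longrightarrow> d dvd m \<Longrightarrow> mod_holds d a A"
  by (cases A) (auto intro: cong_dvd_modulus_nat)

lemma mod_holds_prod:
  assumes "\<And>k l. k \<in> K \<Longrightarrow> l \<in> K \<Longrightarrow> k \<noteq> l \<Longrightarrow> coprime (m k) (m l)"
    and "\<And>k. k \<in> K \<Longrightarrow> mod_holds (m k) a A"
  shows "mod_holds (\<Prod>k\<in>K. m k) a A"
  using assms by (cases A) (auto intro!: coprime_cong_prod_nat)

lemma holds_imp_mod_holds:
  assumes "holds w A" "\<And>i. i \<in> vars A \<Longrightarrow> [a i = w i] (mod m)"
  shows "mod_holds m a A"
proof (cases A)
  case (Add i j k)
  with assms(2) have "[a i + a j = w i + w j] (mod m)" "[a k = w k] (mod m)"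
    by (auto intro: cong_add)
  with assms(1) Add show ?thesis by (simp add: cong_def)
next
  case (Mul i j k)
  with assms(2) have "[a i * a j = w i * w j] (mod m)" "[a k = w k] (mod m)"
    by (auto intro: cong_mult)
  with assms(1) Mul show ?thesis by (simp add: cong_def)
qed (use assms in auto)

text \<open>Sums and products of residues at most \<open>u\<close> do not wrap around modulo
  \<open>p\<close>.\<close>

lemma mod_holds_imp_holds:
  assumes "mod_holds p a A" "\<And>i. i \<in> vars A \<Longrightarrow> a i mod p \<le> u" "(Suc u)\<^sup>2 < p"
  shows "holds (\<lambda>i. a i mod p) A"
proof -
  have u: "2 * u < p" "u * u < p" "1 < p" "u < p" using assms(3) by (auto simp: power2_eq_square)
  show ?thesis
  proof (cases A)
    case (Add i j k)
    have "a i mod p + a j mod p < p" using assms(2)[of i] assms(2)[of j] Add u by simp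
    then have "a i mod p + a j mod p = (a i + a j) mod p" by (metis mod_add_eq mod_less)
    with assms(1) Add show ?thesis by (simp add: cong_def)
  next
    case (Mul i j k)
    have "(a i mod p) * (a j mod p) \<le> u * u" using assms(2)[of i] assms(2)[of j] Mul by (intro mult_le_mono) auto
    then have "(a i mod p) * (a j mod p) = (a i * a j) mod p" using u by (metis le_less_trans mod_less mod_mult_eq)
    with assms(1) Mul show ?thesis by (simp add: cong_def)
  next
    case (One i)
    with assms(1) u show ?thesis by (simp add: cong_def)
  qed
qed

text \<open>The prime divides one of the factors \<open>N - j\<close> with \<open>j \<le> u\<close>
  of the falling factorial. A single divisibility thus bounds a residue, with no quantifier over the
  moduli.\<close>

lemma dvd_binomial_residue:
  fixes N u p :: nat
  assumes "prime p" "p dvd N choose Suc u"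
  shows "N mod p \<le> u"
proof (cases "N \<le> u")
  case True
  then show ?thesis by (meson le_trans mod_less_eq_dividend)
next
  case False
  have "p dvd (\<Prod>j<Suc u. N - j)" unfolding prod_diff_eq_binomial_fact using assms(2) by simp
  then obtain j where j: "j \<le> u" "p dvd N - j"
    using assms(1) by (auto simp: prime_dvd_prod_iff less_Suc_eq_le simp del: prod.lessThan_Suc)
  then have "[N = j] (mod p)" using False by (simp add: cong_altdef_nat)
  then have "N mod p = j mod p" by (simp add: cong_def)
  then show ?thesis using j(1) by (metis le_trans mod_less_eq_dividend)
qed

text \<open>The moduli for the Chinese remainder coding are \<open>1 + q div k\<close>. Since \<open>k * (1 + q div k) = q + k\<close>,
  their product is \<open>(q + n) choose n\<close>, and \<open>k\<close> is congruent to \<open>- q\<close> modulo the \<open>k\<close>-th one, so that a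
  single number codes the index itself.\<close>

locale index_moduli =
  fixes W q n :: nat
  assumes fact_dvd: "(fact W)\<^sup>2 dvd q" and q_pos: "0 < q" and n_le: "n \<le> W"
begin

definition modulus :: "nat \<Rightarrow> nat" where "modulus k = 1 + q div k"

lemma mult_modulus: "k \<in> {1..n} \<Longrightarrow> k * modulus k = q + k"
proof -
  assume "k \<in> {1..n}"
  then have "k dvd fact W" using n_le by (intro dvd_fact) auto
  then have "k dvd q" using fact_dvd by (metis dvd_trans dvd_mult2 power2_eq_square)
  then show ?thesis by (simp add: modulus_def algebra_simps)
qed

text \<open>The square in \<open>fact_dvd\<close> matters here: after division by \<open>k\<close>,
  a full factor \<open>fact W\<close> remains in \<open>q div k\<close>, so no prime up to
  \<open>W\<close> divides \<open>1 + q div k\<close>.\<close>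

lemma prime_dvd_modulus:
  assumes "k \<in> {1..n}" "prime p" "p dvd modulus k"
  shows "W < p"
proof (rule ccontr)
  assume "\<not> W < p"
  then have "p dvd fact W" using assms(2) by (simp add: prime_dvd_fact_iff)
  obtain c where c: "fact W = k * c" using dvd_fact[of k W] assms(1) n_le by auto
  obtain t where "q = (fact W)\<^sup>2 * t" using fact_dvd by blast
  then have "q = k * (c * fact W * t)" by (simp add: power2_eq_square c)
  then have "q div k = c * fact W * t" using assms(1) by simp
  then have "p dvd q div k" using \<open>p dvd fact W\<close> by simp
  then have "p dvd 1" using assms(3) unfolding modulus_def by (metis dvd_add_left_iff)
  then show False using assms(2) by simp
qed

text \<open>A common prime factor would divide \<open>q + l\<close> and \<open>q + k\<close>, hence
  their difference, which is smaller than \<open>W\<close>.\<close>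

lemma coprime_modulus:
  assumes "k \<in> {1..n}" "l \<in> {1..n}" "k \<noteq> l"
  shows "coprime (modulus k) (modulus l)"
proof -
  have "coprime (modulus k) (modulus l)" if kl: "k \<in> {1..n}" "l \<in> {1..n}" "k < l" for k l
  proof (rule coprime_natI)
    fix p assume p: "prime p" "p dvd modulus k" "p dvd modulus l"
    then have "p dvd k * modulus k" "p dvd l * modulus l" by simp_all
    then have "p dvd (q + l) - (q + k)" using mult_modulus kl by (metis dvd_diff_nat)
    then have "p dvd l - k" by simp
    then have "p \<le> l - k" using kl by (intro dvd_imp_le) auto
    moreover have "W < p" using prime_dvd_modulus kl(1) p by blast
    ultimately show False using kl n_le by auto
  qed
  then show ?thesis using assms by (metis coprime_commute linorder_neqE_nat)
qed

lemma prod_modulus: "(\<Prod>k=1..n. modulus k) = (q + n) choose n"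
proof -
  have "fact n * (\<Prod>k=1..n. modulus k) = (\<Prod>k=1..n. k * modulus k)"
    by (simp add: prod.distrib fact_prod)
  also have "\<dots> = (\<Prod>k=1..n. q + k)" by (rule prod.cong) (simp_all only: mult_modulus)
  also have "\<dots> = fact n * ((q + n) choose n)" unfolding prod_add_eq_binomial_fact by (simp only: mult.commute)
  finally show ?thesis by simp
qed

lemma modulus_dvd: "k \<in> {1..n} \<Longrightarrow> modulus k dvd (q + n) choose n"
  unfolding prod_modulus[symmetric] by (rule dvd_prodI) auto

lemma dvd_if_modulus_dvd: "(\<And>k. k \<in> {1..n} \<Longrightarrow> modulus k dvd x) \<Longrightarrow> ((q + n) choose n) dvd x"
  using coprime_cong_prod_nat[of "{1..n}" modulus x 0] coprime_modulus
  unfolding prod_modulus[symmetric] by (auto simp: cong_0_iff)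

end

text \<open>\<open>a i\<close> codes the i-th variable of the instances 1 to \<open>n\<close> by its
  residues modulo the \<open>n\<close> moduli, whose product is the binomial coefficient. The
  condition on \<open>a 0\<close> makes it code the instance number. Slots 1 to \<open>M - 1\<close>
  hold shared parameters, and \<open>u\<close> bounds parameters and residues.\<close>

definition bounded_system :: "nat \<Rightarrow> nat \<Rightarrow> atom list \<Rightarrow> nat \<Rightarrow> nat \<Rightarrow> nat \<Rightarrow> (nat \<Rightarrow> nat) \<Rightarrow> bool" where
  "bounded_system M M' E n u q a \<longleftrightarrow> 1 \<le> u \<and> n \<le> u \<and> (\<forall>i<M. i = 0 \<or> a i \<le> u) \<and> 0 < q \<and>
     (fact ((Suc u)\<^sup>2))\<^sup>2 dvd q \<and> ((q + n) choose n) dvd a 0 + q \<and>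
     (\<forall>i<M'. ((q + n) choose n) dvd (a i choose Suc u)) \<and>
     (\<forall>A\<in>set E. mod_holds ((q + n) choose n) a A)"

text \<open>Instance \<open>k\<close> is read off modulo a prime factor \<open>p\<close> of the k-th
  modulus. Since \<open>p\<close> exceeds \<open>(Suc u)\<^sup>2\<close>, congruences between the
  small residues are equations.\<close>

lemma bounded_system_sound:
  assumes sys: "bounded_system M M' E n u q a" and k: "k \<in> {1..n}"
    and E: "\<And>A. A \<in> set E \<Longrightarrow> vars A \<subseteq> {..<M'}"
  obtains w where "w 0 = k" "\<forall>i<M. i = 0 \<or> w i = a i" "\<forall>A\<in>set E. holds w A"
proof -
  define W where "W = (Suc u)\<^sup>2"
  have "u \<le> W" by (simp add: W_def power2_eq_square)
  interpret index_moduli W q n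
    using sys \<open>u \<le> W\<close> by unfold_locales (auto simp: bounded_system_def W_def)
  have "k dvd q + k" using mult_modulus[OF k] by (metis dvd_triv_left)
  then have "0 < q div k" using q_pos k by (metis atLeastAtMost_iff div_greater_zero_iff dvd_add_left_iff dvd_imp_le dvd_refl less_eq_Suc_le One_nat_def)
  then have "modulus k \<noteq> 1" by (simp add: modulus_def)
  then obtain p where p: "prime p" "p dvd modulus k" using prime_factor_nat by blast
  have pW: "W < p" using prime_dvd_modulus[OF k p] .
  have pQ: "p dvd (q + n) choose n" using p(2) modulus_dvd[OF k] by (rule dvd_trans)
  show thesis
  proof
    \<comment> \<open>Both \<open>k\<close> and \<open>a 0\<close> are congruent to
      \<open>- q\<close> modulo \<open>p\<close>.\<close>
    have "p dvd q + k" using p(2) mult_modulus[OF k] by (metis dvd_mult)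
    moreover have "p dvd a 0 + q" using sys pQ by (auto simp: bounded_system_def intro: dvd_trans)
    ultimately have "[q + a 0 = q + k] (mod p)" by (simp add: cong_def add.commute)
    then have "[a 0 = k] (mod p)" by (simp only: cong_add_lcancel_nat)
    then show "a 0 mod p = k" using k pW n_le by (simp add: cong_def)
    have "u < p" using \<open>u \<le> W\<close> pW by simp
    then show "\<forall>i<M. i = 0 \<or> a i mod p = a i" using sys by (auto simp: bounded_system_def)
    show "\<forall>A\<in>set E. holds (\<lambda>i. a i mod p) A"
    proof
      fix A assume A: "A \<in> set E"
      show "holds (\<lambda>i. a i mod p) A"
      proof (rule mod_holds_imp_holds)
        show "mod_holds p a A" using sys A pQ by (auto simp: bounded_system_def intro: mod_holds_dvd)
        show "(Suc u)\<^sup>2 < p" using pW by (simp add: W_def)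
        show "a i mod p \<le> u" if "i \<in> vars A" for i
          using that E[OF A] sys pQ p(1)
          by (intro dvd_binomial_residue) (auto simp: bounded_system_def intro: dvd_trans)
      qed
    qed
  qed
qed

lemma bounded_system_complete:
  assumes w: "\<And>k. k \<in> {1..n} \<Longrightarrow> w k 0 = k \<and> (\<forall>i<M. i = 0 \<or> w k i = x i) \<and> (\<forall>A\<in>set E. holds (w k) A)"
    and E: "\<And>A. A \<in> set E \<Longrightarrow> vars A \<subseteq> {..<M'}" and M: "0 < M" "M \<le> M'"
  obtains u q a where "bounded_system M M' E n u q a" "\<forall>i<M. i = 0 \<or> a i = x i"
proof -
  have "finite ({1, n} \<union> x ` {..<M} \<union> (\<lambda>(k, i). w k i) ` ({1..n} \<times> {..<M'}))" by simp
  then obtain u where u0: "\<forall>z\<in>{1, n} \<union> x ` {..<M} \<union> (\<lambda>(k, i). w k i) ` ({1..n} \<times> {..<M'}). z \<le> u"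
    using finite_nat_set_iff_bounded_le by blast
  then have u: "1 \<le> u" "n \<le> u" "\<And>i. i < M \<Longrightarrow> x i \<le> u"
    "\<And>k i. k \<in> {1..n} \<Longrightarrow> i < M' \<Longrightarrow> w k i \<le> u" by fastforce+
  define W where "W = (Suc u)\<^sup>2"
  define q where "q = (fact W :: nat)\<^sup>2"
  have W: "Suc u \<le> W" by (simp add: W_def power2_eq_square)
  interpret index_moduli W q n
    using W u by unfold_locales (auto simp: q_def)
  have "\<exists>y. \<forall>k\<in>{1..n}. [y = w k i] (mod modulus k)" for i
    by (rule chinese_remainder_nat) (use coprime_modulus in auto)
  then obtain y where y: "\<And>i k. k \<in> {1..n} \<Longrightarrow> [y i = w k i] (mod modulus k)" by metis
  \<comment> \<open>Parameters agree in all instances, so they stand for themselves instead of being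
    coded.\<close>
  define a where "a i = (if 0 < i \<and> i < M then x i else y i)" for i
  have a: "[a i = w k i] (mod modulus k)" if "k \<in> {1..n}" for i k
    using y[OF that] w[OF that] by (auto simp: a_def)
  have "((q + n) choose n) dvd a 0 + q"
  proof (rule dvd_if_modulus_dvd)
    fix k assume k: "k \<in> {1..n}"
    have "[a 0 + q = k + q] (mod modulus k)" using a[OF k, of 0] w[OF k] by (simp add: cong_add)
    moreover have "modulus k dvd k + q" using mult_modulus[OF k] by (metis add.commute dvd_triv_right)
    ultimately show "modulus k dvd a 0 + q" by (simp add: cong_dvd_iff)
  qed
  moreover have "((q + n) choose n) dvd (a i choose Suc u)" if i: "i < M'" for i
  proof (rule dvd_if_modulus_dvd)
    fix k assume k: "k \<in> {1..n}"
    show "modulus k dvd (a i choose Suc u)"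
    proof (cases "a i \<le> u")
      case False
      have "w k i \<le> u" using u(4)[OF k i] .
      then have "modulus k dvd a i - w k i" using a[OF k, of i] False by (simp add: cong_altdef_nat)
      \<comment> \<open>As \<open>w k i\<close> is at most \<open>u\<close>, this difference is one
        factor of the falling factorial. The factorial is cancelled below because the modulus has
        large prime factors only.\<close>
      also have "\<dots> dvd (\<Prod>j<Suc u. a i - j)" using \<open>w k i \<le> u\<close> by (intro dvd_prodI) auto
      finally have "modulus k dvd (a i choose Suc u) * fact (Suc u)" unfolding prod_diff_eq_binomial_fact .
      moreover have "coprime (modulus k) (fact (Suc u))"
      proof (rule coprime_natI)
        fix p assume p: "prime p" "p dvd modulus k" "p dvd fact (Suc u)"
        then have "p \<le> Suc u" using prime_dvd_fact_iff by blast
        then show False using prime_dvd_modulus[OF k p(1,2)] W by simp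
      qed
      ultimately show ?thesis by (simp only: coprime_dvd_mult_left_iff)
    qed (simp add: binomial_eq_0)
  qed
  moreover have "mod_holds ((q + n) choose n) a A" if A: "A \<in> set E" for A
    unfolding prod_modulus[symmetric]
  proof (rule mod_holds_prod)
    fix k assume k: "k \<in> {1..n}"
    show "mod_holds (modulus k) a A"
      by (rule holds_imp_mod_holds[of "w k"]) (use w[OF k] A a[OF k] in auto)
  qed (use coprime_modulus in auto)
  ultimately have "bounded_system M M' E n u q a"
    using u q_pos fact_dvd by (auto simp: bounded_system_def a_def W_def)
  moreover have "\<forall>i<M. i = 0 \<or> a i = x i" by (simp add: a_def)
  ultimately show thesis by (rule that)
qed

lemma dioph_bounded_system:
  assumes "dfun f" "dfun g" "dfun h"
  shows "dioph (\<lambda>v. bounded_system M M' E (f v) (g v) (h v) (\<lambda>i. v (\<rho> i)))"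
  unfolding bounded_system_def power2_eq_square
  by (intro dioph_intros dioph_ball_list dioph_all_less dioph_mod_holds assms)

lemma dioph_all_atLeastAtMost:
  assumes P: "dioph (\<lambda>v. P (v 0) (\<lambda>i. v (Suc i)))" and f: "dfun f"
  shows "dioph (\<lambda>v. \<forall>k\<in>{1..f v}. P k v)"
proof -
  obtain N where N: "\<And>v w. (\<And>i. i < N \<Longrightarrow> v i = w i) \<Longrightarrow>
      P (v 0) (\<lambda>i. v (Suc i)) \<longleftrightarrow> P (w 0) (\<lambda>i. w (Suc i))"
    using dioph_finite_support[OF P] by blast
  define M where "M = Suc (Suc N)"
  \<comment> \<open>Slot 1 is skipped for the bound; indices from \<open>M\<close> on lie beyond the
    support and may be sent to 0.\<close>
  define \<rho> where "\<rho> i = (if i < M \<and> i \<noteq> 0 then Suc i else 0)" for i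
  obtain E M' where E: "Suc M \<le> M'" "\<And>A. A \<in> set E \<Longrightarrow> vars A \<subseteq> {..<M'}"
    "\<And>v. P (v (\<rho> 0)) (\<lambda>i. v (\<rho> (Suc i))) \<longleftrightarrow> (\<exists>w. (\<forall>i<Suc M. w i = v i) \<and> (\<forall>A\<in>set E. holds w A))"
    by (rule dioph_prenex[OF P, of \<rho> "Suc M"]) (auto simp: \<rho>_def)
  \<comment> \<open>Index 0 holds \<open>k\<close>, index 1 the bound, and the parameters follow.\<close>
  define env where "env k n v = case_nat k (case_nat n v)" for k n :: nat and v
  have PE: "P k v \<longleftrightarrow> (\<exists>w. (\<forall>i<Suc M. w i = env k n v i) \<and> (\<forall>A\<in>set E. holds w A))" for k n v
    using E(3)[of "env k n v"] N[of "case_nat k v" "\<lambda>i. env k n v (\<rho> i)"]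
    by (auto simp: env_def \<rho>_def M_def split: nat.splits)
  \<comment> \<open>Slot 0 of \<open>a\<close> codes every \<open>k\<close> simultaneously, so its
    value \<open>z\<close> is left free.\<close>
  have eq: "(\<forall>k\<in>{1..n}. P k v) \<longleftrightarrow>
    (\<exists>z a. (\<forall>i<Suc M. a i = env z n v i) \<and> (\<exists>u q. bounded_system (Suc M) M' E (a 1) u q a))"
    (is "?L \<longleftrightarrow> ?R") for n v
  proof
    assume ?L
    then have "\<forall>k\<in>{1..n}. \<exists>w. (\<forall>i<Suc M. w i = env k n v i) \<and> (\<forall>A\<in>set E. holds w A)"
      using PE by blast
    then obtain w where w: "\<And>k. k \<in> {1..n} \<Longrightarrow> (\<forall>i<Suc M. w k i = env k n v i) \<and> (\<forall>A\<in>set E. holds (w k) A)"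
      by metis
    have "w k 0 = k \<and> (\<forall>i<Suc M. i = 0 \<or> w k i = env 0 n v i) \<and> (\<forall>A\<in>set E. holds (w k) A)"
      if "k \<in> {1..n}" for k
      using w[OF that] by (auto simp: env_def split: nat.splits)
    then obtain u q a where a: "bounded_system (Suc M) M' E n u q a" "\<forall>i<Suc M. i = 0 \<or> a i = env 0 n v i"
      using bounded_system_complete[of n w "Suc M" "env 0 n v" E M'] E(1,2) by blast
    have "a 1 = n" using a(2) by (auto simp: env_def M_def)
    moreover have "\<forall>i<Suc M. a i = env (a 0) n v i" using a(2) by (auto simp: env_def split: nat.splits)
    ultimately show ?R using a(1) by blast
  next
    assume ?R
    then obtain z a u q where a: "\<forall>i<Suc M. a i = env z n v i" "bounded_system (Suc M) M' E (a 1) u q a" by blast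
    have "a 1 = n" using a(1) by (auto simp: env_def M_def)
    show ?L
    proof
      fix k assume "k \<in> {1..n}"
      then obtain w where w: "w 0 = k" "\<forall>i<Suc M. i = 0 \<or> w i = a i" "\<forall>A\<in>set E. holds w A"
        using bounded_system_sound[OF a(2), of k] E(2) \<open>a 1 = n\<close> by blast
      have "\<forall>i<Suc M. w i = env k n v i"
        using w(1,2) a(1) by (auto simp: env_def split: nat.splits)
      then show "P k v" using w(3) PE by blast
    qed
  qed
  define D where
    "D v \<longleftrightarrow> (\<exists>a. (\<forall>i<Suc M. a i = v i) \<and> (\<exists>u q. bounded_system (Suc M) M' E (a 1) u q a))" for v
  have "dioph D"
    unfolding D_def by (intro dioph_ex_block dioph_ex dioph_bounded_system dfun_var)
  moreover have "(\<lambda>i. v (if i = 0 then 1 else if i = 1 then 0 else i)) =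
      env (v 1) (v 0) (\<lambda>i. v (Suc (Suc i)))" for v
    by (auto simp: env_def fun_eq_iff split: nat.split)
  ultimately have "dioph (\<lambda>v. D (env (v 1) (v 0) (\<lambda>i. v (Suc (Suc i)))))"
    using dioph_rename[of D "\<lambda>i. if i = 0 then 1 else if i = 1 then 0 else i"] by (simp only:)
  then have "dioph (\<lambda>v. D (env (v 0) (f (\<lambda>i. v (Suc i))) (\<lambda>i. v (Suc i))))"
    by (intro dioph_subst1[of "\<lambda>n v. D (env (v 0) n (\<lambda>i. v (Suc i)))"] dfun_rename[OF f]) simp
  from dioph_ex[of "\<lambda>z v. D (env z (f v) v)", OF this] show ?thesis unfolding eq D_def .
qed

lemma dioph_all_less_dfun:
  assumes P: "dioph (\<lambda>v. P (v 0) (\<lambda>i. v (Suc i)))" and f: "dfun f"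
  shows "dioph (\<lambda>v. \<forall>k<f v. P k v)"
proof -
  have eq: "(\<forall>k<n. P k v) \<longleftrightarrow> (\<forall>k\<in>{1..n}. \<exists>j. Suc j = k \<and> P j v)" (is "?L \<longleftrightarrow> ?R") for n v
  proof
    assume ?L
    show ?R
    proof
      fix k assume "k \<in> {1..n}"
      with \<open>?L\<close> show "\<exists>j. Suc j = k \<and> P j v" by (intro exI[of _ "k - 1"]) auto
    qed
  next
    assume R: ?R
    show ?L
    proof (intro allI impI)
      fix k assume "k < n"
      then have "Suc k \<in> {1..n}" by simp
      with R show "P k v" by blast
    qed
  qed
  have "dioph (\<lambda>v. P (v 0) (\<lambda>i. v (Suc (Suc i))))"
    using dioph_rename[OF P, of "case_nat 0 (\<lambda>i. Suc (Suc i))"] by simp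
  then show ?thesis unfolding eq
    by (intro dioph_all_atLeastAtMost f dioph_intros)
qed

section \<open>Graphs of partial recursive functions\<close>

text \<open>Runs of a primitive recursion are coded as digits of \<open>a\<close> in base
  \<open>Suc b\<close>, with \<open>b\<close> large enough to bound every entry. Digit extraction is
  Diophantine because exponentiation is.\<close>

lemma exists_digits:
  fixes s :: "nat \<Rightarrow> nat"
  obtains a b where "\<And>k. k \<le> n \<Longrightarrow> a div Suc b ^ k mod Suc b = s k"
proof -
  define b where "b = (\<Sum>i\<le>n. s i)"
  define d where "d i = (if i \<le> n then s i else 0)" for i
  have "d i < Suc b" for i
    unfolding d_def b_def by (auto simp: less_Suc_eq_le intro: member_le_sum)
  note digit = sum_digits_div_mod[of d "Suc b" "Suc n", OF this]
  show thesis
    by (rule that[of "\<Sum>i<Suc n. d i * Suc b ^ i" b]) (subst digit, simp add: d_def)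
qed

inductive_cases rec_eval_ZeroE: "rec_eval Zero xs y"
inductive_cases rec_eval_SuccE: "rec_eval Succ xs y"
inductive_cases rec_eval_ProjE: "rec_eval (Proj i) xs y"
inductive_cases rec_eval_CompE: "rec_eval (Comp f gs) xs y"
inductive_cases rec_eval_PrimRecE: "rec_eval (PrimRec f g) xs y"
inductive_cases rec_eval_PrimRec0E: "rec_eval (PrimRec f g) (0 # xs) y"
inductive_cases rec_eval_PrimRecSucE: "rec_eval (PrimRec f g) (Suc n # xs) y"
inductive_cases rec_eval_MuE: "rec_eval (Mu f) xs y"

lemma rec_eval_Zero_iff: "rec_eval Zero xs y \<longleftrightarrow> y = 0"
  by (auto elim: rec_eval_ZeroE intro: rec_eval.Zero)

lemma rec_eval_Succ_iff: "rec_eval Succ xs y \<longleftrightarrow> (\<exists>x. xs = [x] \<and> y = Suc x)"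
  by (auto elim: rec_eval_SuccE intro: rec_eval.Succ)

lemma rec_eval_Proj_iff: "rec_eval (Proj i) xs y \<longleftrightarrow> i < length xs \<and> y = xs ! i"
  by (auto elim: rec_eval_ProjE intro: rec_eval.Proj)

lemma rec_eval_Comp_iff:
  "rec_eval (Comp f gs) xs z \<longleftrightarrow> (\<exists>ys. list_all2 (\<lambda>g. rec_eval g xs) gs ys \<and> rec_eval f ys z)"
  by (auto elim!: rec_eval_CompE intro: rec_eval.Comp simp: list_all2_conv_all_nth) metis

lemma rec_eval_Mu_iff:
  "rec_eval (Mu f) xs n \<longleftrightarrow> rec_eval f (n # xs) 0 \<and> (\<forall>k<n. \<exists>y. rec_eval f (k # xs) (Suc y))"
  by (auto elim: rec_eval_MuE intro: rec_eval.Mu)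

lemma rec_eval_PrimRec_Nil: "\<not> rec_eval (PrimRec f g) [] y"
  by (auto elim: rec_eval_PrimRecE)

lemma rec_eval_PrimRec_sequence:
  "rec_eval (PrimRec f g) (n # xs) y \<longleftrightarrow>
    (\<exists>s. rec_eval f xs (s 0) \<and> (\<forall>k<n. rec_eval g (k # s k # xs) (s (Suc k))) \<and> y = s n)"
proof (induction n arbitrary: y)
  case 0
  have "rec_eval (PrimRec f g) (0 # xs) y \<longleftrightarrow> rec_eval f xs y"
    by (auto elim: rec_eval_PrimRec0E intro: rec_eval.PrimRec_0)
  then show ?case by auto
next
  case (Suc n)
  show ?case
  proof
    assume "rec_eval (PrimRec f g) (Suc n # xs) y"
    then obtain z where "rec_eval (PrimRec f g) (n # xs) z" and z: "rec_eval g (n # z # xs) y"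
      by (auto elim: rec_eval_PrimRecSucE)
    then obtain s where s: "rec_eval f xs (s 0)" "\<forall>k<n. rec_eval g (k # s k # xs) (s (Suc k))" "z = s n"
      using Suc by blast
    then show "\<exists>s. rec_eval f xs (s 0) \<and> (\<forall>k<Suc n. rec_eval g (k # s k # xs) (s (Suc k))) \<and> y = s (Suc n)"
      using z by (intro exI[of _ "s(Suc n := y)"]) (auto simp: less_Suc_eq)
  next
    assume "\<exists>s. rec_eval f xs (s 0) \<and> (\<forall>k<Suc n. rec_eval g (k # s k # xs) (s (Suc k))) \<and> y = s (Suc n)"
    then obtain s where s: "rec_eval f xs (s 0)" "\<forall>k<Suc n. rec_eval g (k # s k # xs) (s (Suc k))" "y = s (Suc n)"
      by blast
    then have "rec_eval (PrimRec f g) (n # xs) (s n)" using Suc by auto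
    then show "rec_eval (PrimRec f g) (Suc n # xs) y" using s by (auto intro: rec_eval.PrimRec_Suc)
  qed
qed

lemma rec_eval_PrimRec_iff:
  "rec_eval (PrimRec f g) (n # xs) y \<longleftrightarrow> (\<exists>a b. rec_eval f xs (a mod Suc b) \<and>
    (\<forall>k<n. rec_eval g (k # (a div Suc b ^ k mod Suc b) # xs) (a div Suc b ^ Suc k mod Suc b)) \<and>
    y = a div Suc b ^ n mod Suc b)" (is "_ \<longleftrightarrow> ?R")
proof
  assume "rec_eval (PrimRec f g) (n # xs) y"
  then obtain s where s: "rec_eval f xs (s 0)" "\<forall>k<n. rec_eval g (k # s k # xs) (s (Suc k))" "y = s n"
    unfolding rec_eval_PrimRec_sequence by blast
  obtain a b where ab: "\<And>k. k \<le> n \<Longrightarrow> a div Suc b ^ k mod Suc b = s k" using exists_digits by blast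
  have "a mod Suc b = s 0" using ab[of 0] by simp
  with s ab show ?R
    by (intro exI[of _ a] exI[of _ b]) (simp del: power_Suc)
next
  assume ?R
  then obtain a b where "rec_eval f xs (a div Suc b ^ 0 mod Suc b)"
    "\<forall>k<n. rec_eval g (k # (a div Suc b ^ k mod Suc b) # xs) (a div Suc b ^ Suc k mod Suc b)"
    "y = a div Suc b ^ n mod Suc b" by auto
  then show "rec_eval (PrimRec f g) (n # xs) y"
    unfolding rec_eval_PrimRec_sequence by (intro exI[of _ "\<lambda>k. a div Suc b ^ k mod Suc b"]) blast
qed

text \<open>Arguments are arbitrary Diophantine functions instead of slots, which lets the induction
  over programs substitute freely.\<close>

definition rec_dioph :: "recf \<Rightarrow> bool" where
  "rec_dioph f \<longleftrightarrow> (\<forall>hs g. (\<forall>h\<in>set hs. dfun h) \<longrightarrow> dfun g \<longrightarrow>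
     dioph (\<lambda>v. rec_eval f (map (\<lambda>h. h v) hs) (g v)))"

lemma rec_diophD:
  assumes "rec_dioph f" "\<forall>h\<in>set hs. dfun h" "dfun g"
  shows "dioph (\<lambda>v. rec_eval f (map (\<lambda>h. h v) hs) (g v))"
  using assms by (simp add: rec_dioph_def)

lemma rec_diophD_rename:
  assumes "rec_dioph f" "\<forall>h\<in>set hs'. dfun h" "\<forall>h\<in>set hs. dfun h" "dfun g"
  shows "dioph (\<lambda>v. rec_eval f (map (\<lambda>h. h v) hs' @ map (\<lambda>h. h (\<lambda>i. v (\<rho> i))) hs) (g v))"
proof -
  have "\<forall>h\<in>set (hs' @ map (\<lambda>h v. h (\<lambda>i. v (\<rho> i))) hs). dfun h"
    using assms(2,3) dfun_rename by auto
  from rec_diophD[OF assms(1) this assms(4)] show ?thesis by (simp add: comp_def)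
qed

text \<open>The intermediate values are quantified one at a time; \<open>zs\<close> collects those
  already chosen.\<close>

lemma dioph_Comp:
  assumes f: "rec_dioph f" and hs: "\<forall>h\<in>set hs. dfun h" and g: "dfun g"
    and gs: "\<forall>e\<in>set gs. rec_dioph e" and zs: "\<forall>h\<in>set zs. dfun h"
  shows "dioph (\<lambda>v. \<exists>ys. list_all2 (\<lambda>e. rec_eval e (map (\<lambda>h. h v) hs)) gs ys \<and>
    rec_eval f (map (\<lambda>h. h v) zs @ ys) (g v))"
  using assms
proof (induction gs arbitrary: hs g zs)
  case Nil
  then show ?case by (simp add: rec_diophD)
next
  case (Cons e gs)
  define sh where "sh h v = h (\<lambda>i. v (Suc i))" for h :: "(nat \<Rightarrow> nat) \<Rightarrow> nat" and v
  have sh: "dfun h \<Longrightarrow> dfun (sh h)" for h unfolding sh_def by (rule dfun_rename)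
  have eq: "(\<exists>ys. list_all2 (\<lambda>e. rec_eval e xs) (e # gs) ys \<and> rec_eval f (us @ ys) z) \<longleftrightarrow>
    (\<exists>y. rec_eval e xs y \<and> (\<exists>ys. list_all2 (\<lambda>e. rec_eval e xs) gs ys \<and> rec_eval f ((us @ [y]) @ ys) z))"
    for xs us z by (auto simp: list_all2_Cons1)
  have "dioph (\<lambda>v. rec_eval e (map (\<lambda>h. h v) (map sh hs)) (v 0))"
    using Cons.prems by (intro rec_diophD dfun_var) (auto simp: sh)
  moreover have "dioph (\<lambda>v. \<exists>ys. list_all2 (\<lambda>e. rec_eval e (map (\<lambda>h. h v) (map sh hs))) gs ys \<and>
      rec_eval f (map (\<lambda>h. h v) (map sh zs @ [\<lambda>v. v 0]) @ ys) (sh g v))"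
    using Cons.prems by (intro Cons.IH) (auto simp: sh dfun_var)
  ultimately show ?case unfolding eq
    by (intro dioph_ex dioph_conj) (simp_all add: sh_def comp_def)
qed

lemma rec_dioph: "rec_dioph f"
proof (induction f)
  case Zero
  then show ?case unfolding rec_dioph_def rec_eval_Zero_iff using dioph_eq[OF _ dfun_const[of 0]] by blast
next
  case Succ
  have "dioph (\<lambda>v. rec_eval Succ (map (\<lambda>h. h v) hs) (g v))"
    if "\<forall>h\<in>set hs. dfun h" "dfun g" for hs :: "((nat \<Rightarrow> nat) \<Rightarrow> nat) list" and g
  proof (cases "\<exists>h. hs = [h]")
    case True
    then obtain h where "hs = [h]" by blast
    with that show ?thesis by (simp add: rec_eval_Succ_iff dioph_eq dfun_SucI)
  next
    case False
    then have "\<not> rec_eval Succ (map (\<lambda>h. h v) hs) (g v)" for v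
      by (auto simp: rec_eval_Succ_iff map_eq_Cons_conv)
    then show ?thesis by (simp add: dioph_False)
  qed
  then show ?case by (simp add: rec_dioph_def)
next
  case (Proj i)
  have "dioph (\<lambda>v. i < length hs \<and> g v = map (\<lambda>h. h v) hs ! i)"
    if "\<forall>h\<in>set hs. dfun h" "dfun g" for hs and g
    by (rule dioph_conj_const) (use that in \<open>simp add: dioph_eq\<close>)
  then show ?case by (simp add: rec_dioph_def rec_eval_Proj_iff)
next
  case (Comp f gs)
  show ?case unfolding rec_dioph_def rec_eval_Comp_iff
    using dioph_Comp[of f _ _ gs "[]"] Comp by simp
next
  case (PrimRec f g)
  have "dioph (\<lambda>v. rec_eval (PrimRec f g) (map (\<lambda>h. h v) hs) (y v))"
    if hs: "\<forall>h\<in>set hs. dfun h" and y: "dfun y" for hs and y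
  proof (cases hs)
    case Nil
    then show ?thesis by (simp add: rec_eval_PrimRec_Nil dioph_False)
  next
    case (Cons n xs)
    have n: "dfun n" and xs: "\<forall>h\<in>set xs. dfun h" using hs Cons by auto
    \<comment> \<open>Slots 0 and 1 hold \<open>b\<close> and \<open>a\<close> of
      \<open>rec_eval_PrimRec_iff\<close>; under the bounded quantifier of \<open>2\<close>, both
      move up by one.\<close>
    have 1: "dioph (\<lambda>v. rec_eval f (map (\<lambda>h. h (\<lambda>i. v (Suc (Suc i)))) xs) (v 1 mod Suc (v 0)))"
      using rec_diophD_rename[OF PrimRec(1), of "[]" xs "\<lambda>v. v 1 mod Suc (v 0)" "\<lambda>i. Suc (Suc i)"] xs
      by (simp add: dioph_intros)
    have 2: "dioph (\<lambda>v. \<forall>k<n (\<lambda>i. v (Suc (Suc i))).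
      rec_eval g (k # (v 1 div Suc (v 0) ^ k mod Suc (v 0)) # map (\<lambda>h. h (\<lambda>i. v (Suc (Suc i)))) xs)
        (v 1 div Suc (v 0) ^ Suc k mod Suc (v 0)))"
    proof (rule dioph_all_less_dfun)
      have "dioph (\<lambda>v. rec_eval g (map (\<lambda>h. h v) [\<lambda>v. v 0, \<lambda>v. v 2 div Suc (v 1) ^ v 0 mod Suc (v 1)] @
          map (\<lambda>h. h (\<lambda>i. v (Suc (Suc (Suc i))))) xs) (v 2 div Suc (v 1) ^ Suc (v 0) mod Suc (v 1)))"
        by (rule rec_diophD_rename[OF PrimRec(2)]) (use xs in \<open>auto intro!: dioph_intros simp del: power_Suc\<close>)
      then show "dioph (\<lambda>v. rec_eval g (v 0 # (v (Suc 1) div Suc (v (Suc 0)) ^ v 0 mod Suc (v (Suc 0))) #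
          map (\<lambda>h. h (\<lambda>i. v (Suc (Suc (Suc i))))) xs) (v (Suc 1) div Suc (v (Suc 0)) ^ Suc (v 0) mod Suc (v (Suc 0))))"
        by (simp add: numeral_2_eq_2 del: power_Suc)
    qed (rule dfun_rename[OF n])
    have 3: "dioph (\<lambda>v. y (\<lambda>i. v (Suc (Suc i))) = v 1 div Suc (v 0) ^ n (\<lambda>i. v (Suc (Suc i))) mod Suc (v 0))"
      by (intro dioph_intros dfun_rename[OF n] dfun_rename[OF y]) simp_all
    show ?thesis
      unfolding Cons list.map rec_eval_PrimRec_iff
      by (intro dioph_ex dioph_conj) (use 1 2 3 in \<open>simp_all del: power_Suc\<close>)
  qed
  then show ?case by (simp add: rec_dioph_def)
next
  case (Mu f)
  have "dioph (\<lambda>v. rec_eval (Mu f) (map (\<lambda>h. h v) hs) (n v))"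
    if hs: "\<forall>h\<in>set hs. dfun h" and n: "dfun n" for hs and n
  proof -
    have "dioph (\<lambda>v. rec_eval f (n v # map (\<lambda>h. h v) hs) 0)"
      using rec_diophD[OF Mu, of "n # hs" "\<lambda>v. 0"] hs n by (simp add: dfun_const)
    moreover have "dioph (\<lambda>v. \<forall>k<n v. \<exists>y. rec_eval f (k # map (\<lambda>h. h v) hs) (Suc y))"
    proof (intro dioph_all_less_dfun dioph_ex n)
      show "dioph (\<lambda>v. rec_eval f (v (Suc 0) # map (\<lambda>h. h (\<lambda>i. v (Suc (Suc i)))) hs) (Suc (v 0)))"
        using rec_diophD_rename[OF Mu, of "[\<lambda>v. v (Suc 0)]" hs "\<lambda>v. Suc (v 0)" "\<lambda>i. Suc (Suc i)"] hs
        by (simp add: dioph_intros)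
    qed
    ultimately show ?thesis unfolding rec_eval_Mu_iff by (rule dioph_conj)
  qed
  then show ?case by (simp add: rec_dioph_def)
qed

lemma dioph_rec_eval[dioph_intros]:
  "dfun h \<Longrightarrow> dfun g \<Longrightarrow> dioph (\<lambda>v. rec_eval f [h v] (g v))"
  using rec_diophD[OF rec_dioph, of "[h]" g] by simp

section \<open>Sums of four squares\<close>

definition sum4sq :: "int \<Rightarrow> bool" where
  "sum4sq n \<longleftrightarrow> (\<exists>a b c d. n = a * a + b * b + c * c + d * d)"

lemma euler_four_square_identity:
  fixes a b c d w x y z :: "'a::comm_ring_1"
  shows "(a * a + b * b + c * c + d * d) * (w * w + x * x + y * y + z * z) =
    (a * w + b * x + c * y + d * z) * (a * w + b * x + c * y + d * z) +
    (a * x - b * w - c * z + d * y) * (a * x - b * w - c * z + d * y) +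
    (a * y - c * w + b * z - d * x) * (a * y - c * w + b * z - d * x) +
    (a * z - d * w - b * y + c * x) * (a * z - d * w - b * y + c * x)"
  by (simp add: algebra_simps)

lemma sum4sq_mult: "sum4sq m \<Longrightarrow> sum4sq n \<Longrightarrow> sum4sq (m * n)"
  unfolding sum4sq_def by (metis euler_four_square_identity)

text \<open>Pigeonhole: for p = 2 h + 1, the h + 1 residues a^2 and the h + 1 residues - 1 - b^2
  with 0 <= a, b <= h cannot all be distinct.\<close>

lemma prime_dvd_sum_two_squares_plus_one:
  fixes p :: nat
  assumes "prime p" "odd p"
  obtains a b m where "0 < m" "m < p" "a * a + b * b + 1 = m * p"
proof -
  obtain h where h: "p = 2 * h + 1" using assms(2) by (rule oddE)
  have hp: "0 < h" using assms h prime_gt_1_nat[of p] by simp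
  have sq: "a = b" if "a \<le> h" "b \<le> h" "int p dvd int (a * a) - int (b * b)" for a b
  proof -
    have "int p dvd (int a - int b) * (int a + int b)" using that(3) by (simp add: algebra_simps)
    then have "int p dvd int a - int b \<or> int p dvd int a + int b"
      using assms(1) by (simp add: prime_dvd_mult_iff)
    then show ?thesis
    proof
      assume "int p dvd int a - int b"
      then have "int a - int b = 0"
        using dvd_imp_le_int[of "int a - int b" "int p"] that h by fastforce
      then show ?thesis by simp
    next
      assume d: "int p dvd int a + int b"
      have "int a + int b < int p" using that h by simp
      then have "int a + int b = 0" using d zdvd_imp_le[of "int p" "int a + int b"] by fastforce
      then show ?thesis by simp
    qed
  qed
  define f g where "f a = int (a * a) mod int p" and "g b = (- 1 - int (b * b)) mod int p" for a b :: nat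
  have f: "inj_on f {..h}"
    by (rule inj_onI) (use sq in \<open>auto simp: f_def mod_eq_dvd_iff\<close>)
  have g: "inj_on g {..h}"
    by (rule inj_onI) (use sq in \<open>auto simp: g_def mod_eq_dvd_iff dvd_diff_commute\<close>)
  have "f ` {..h} \<inter> g ` {..h} \<noteq> {}"
  proof
    assume "f ` {..h} \<inter> g ` {..h} = {}"
    then have "card (f ` {..h} \<union> g ` {..h}) = card (f ` {..h}) + card (g ` {..h})"
      by (intro card_Un_disjoint) auto
    moreover have "card (f ` {..h}) = Suc h" "card (g ` {..h}) = Suc h" using f g by (simp_all add: card_image)
    moreover have "card (f ` {..h} \<union> g ` {..h}) \<le> card {0..<int p}"
      by (intro card_mono) (use h in \<open>auto simp: f_def g_def\<close>)
    ultimately show False using h by simp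
  qed
  then obtain a b where ab: "a \<le> h" "b \<le> h" "f a = g b" by auto
  then have "int p dvd int (a * a) - (- 1 - int (b * b))" by (simp add: f_def g_def mod_eq_dvd_iff)
  then have "int p dvd int (a * a + b * b + 1)" by (simp add: algebra_simps)
  then have "p dvd a * a + b * b + 1" by (simp only: int_dvd_int_iff)
  then obtain m where m: "a * a + b * b + 1 = m * p" by (metis dvd_def mult.commute)
  have "a * a + b * b \<le> h * h + h * h" using ab by (intro add_mono mult_le_mono)
  then have "m * p < p * p" unfolding m[symmetric] using h hp by simp
  then have "m < p" by simp
  moreover have "0 < m" using m by (cases m) auto
  ultimately show thesis using that m by blast
qed

lemma centered_residue:
  fixes a m :: int
  assumes "m > 0"
  obtains w where "m dvd a - w" "2 * \<bar>w\<bar> \<le> m"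
proof -
  define r where "r = a mod m"
  have r: "0 \<le> r" "r < m" "m dvd a - r" using assms by (auto simp: r_def)
  show thesis
  proof (cases "2 * r \<le> m")
    case True
    then show thesis using that[of r] r by simp
  next
    case False
    have "m dvd (a - r) + m" using r(3) by simp
    then show thesis using that[of "r - m"] r False by (simp add: algebra_simps)
  qed
qed

text \<open>Lagrange's descent. Take the least \<open>m\<close> with m p a sum of four squares. If m
  > 1, centered residues of the four roots and the identity of Euler give a smaller multiplier
  \<open>k\<close>.\<close>

lemma sum4sq_prime:
  assumes "prime p"
  shows "sum4sq (int p)"
proof (cases "odd p")
  case False
  then have "p = 2" using assms primes_dvd_imp_eq two_is_prime_nat by blast
  moreover have "(2::int) = 1 * 1 + 1 * 1 + 0 * 0 + 0 * 0" by simp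
  ultimately show ?thesis unfolding sum4sq_def by (metis of_nat_numeral)
next
  case True
  define P where "P m \<longleftrightarrow> 0 < m \<and> sum4sq (int m * int p)" for m
  obtain a b m0 where m0: "0 < m0" "m0 < p" "a * a + b * b + 1 = m0 * p"
    using prime_dvd_sum_two_squares_plus_one[OF assms True] .
  have "int m0 * int p = int a * int a + int b * int b + 1 * 1 + 0 * 0"
    using arg_cong[OF m0(3), of int] by simp
  then have "P m0" using m0(1) unfolding P_def sum4sq_def by blast
  define m where "m = (LEAST m. P m)"
  have "P m" unfolding m_def using \<open>P m0\<close> by (rule LeastI)
  have least: "m \<le> k" if "P k" for k unfolding m_def using that by (rule Least_le)
  have "m < p" using least[OF \<open>P m0\<close>] m0(2) by simp
  show ?thesis
  proof (cases "m = 1")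
    case True
    then show ?thesis using \<open>P m\<close> by (simp add: P_def)
  next
    case False
    then have m: "1 < m" using \<open>P m\<close> by (simp add: P_def)
    define M where "M = int m"
    have M: "1 < M" using m by (simp add: M_def)
    have not_dvd: "\<not> M * M dvd M * int p"
    proof
      assume "M * M dvd M * int p"
      then have "M dvd int p" using M by simp
      then have "m dvd p" by (simp add: M_def)
      then show False using assms m \<open>m < p\<close> by (metis less_irrefl prime_nat_iff)
    qed
    obtain a b c d where abcd: "M * int p = a * a + b * b + c * c + d * d"
      using \<open>P m\<close> by (auto simp: P_def M_def sum4sq_def)
    obtain w where w: "M dvd a - w" "2 * \<bar>w\<bar> \<le> M" using centered_residue[of M] M by auto
    obtain x where x: "M dvd b - x" "2 * \<bar>x\<bar> \<le> M" using centered_residue[of M] M by auto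
    obtain y where y: "M dvd c - y" "2 * \<bar>y\<bar> \<le> M" using centered_residue[of M] M by auto
    obtain z where z: "M dvd d - z" "2 * \<bar>z\<bar> \<le> M" using centered_residue[of M] M by auto
    define S where "S = w * w + x * x + y * y + z * z"
    have sq: "4 * (t * t) \<le> M * M" if "2 * \<bar>t\<bar> \<le> M" for t
    proof -
      have "(2 * \<bar>t\<bar>) * (2 * \<bar>t\<bar>) \<le> M * M" using that by (intro mult_mono) auto
      then show ?thesis by simp
    qed
    note sqs = sq[OF w(2)] sq[OF x(2)] sq[OF y(2)] sq[OF z(2)]
    have dvd_sq: "M dvd s * s - t * t" if "M dvd s - t" for s t
      using dvd_mult2[OF that, of "s + t"] by (simp add: algebra_simps)
    have "M dvd (a * a - w * w) + (b * b - x * x) + (c * c - y * y) + (d * d - z * z)"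
      using w x y z by (intro dvd_add dvd_sq)
    also have "\<dots> = M * int p - S" unfolding abcd S_def by simp
    finally have "M dvd S" by (metis dvd_diff_commute dvd_triv_left dvd_diffD zdvd_zdiffD)
    then obtain k where k: "S = M * k" by blast
    have "0 \<le> S" "S \<le> M * M" unfolding S_def using sqs by (simp, linarith)
    then have k_le: "0 \<le> k" "k \<le> M" using M by (simp_all add: k zero_le_mult_iff)
    \<comment> \<open>This excludes k = 0, where all residues vanish, and k = M, where all are M/2
      up to sign: M^2 would divide M p, although 1 < m < p.\<close>
    have extremal: "\<not> (M dvd 2 * w \<and> M dvd 2 * x \<and> M dvd 2 * y \<and> M dvd 2 * z \<and> M * M dvd S)"
    proof
      assume *: "M dvd 2 * w \<and> M dvd 2 * x \<and> M dvd 2 * y \<and> M dvd 2 * z \<and> M * M dvd S"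
      have dvd_sq2: "M * M dvd s * s - t * t" if "M dvd s - t" "M dvd 2 * t" for s t
      proof -
        have "M dvd (s - t) + 2 * t" using that by (rule dvd_add)
        with that(1) have "M * M dvd (s - t) * ((s - t) + 2 * t)" by (rule mult_dvd_mono)
        then show ?thesis by (simp add: algebra_simps)
      qed
      have "M * M dvd (a * a - w * w) + (b * b - x * x) + (c * c - y * y) + (d * d - z * z) + S"
        using * w x y z by (intro dvd_add dvd_sq2) auto
      also have "\<dots> = M * int p" unfolding abcd S_def by simp
      finally show False using not_dvd by blast
    qed
    have "k \<noteq> 0"
    proof
      assume "k = 0"
      then have "S = 0" using k by simp
      then have "w * w = 0 \<and> x * x = 0 \<and> y * y = 0 \<and> z * z = 0"
        unfolding S_def using zero_le_square[of w] zero_le_square[of x] zero_le_square[of y] zero_le_square[of z]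
        by linarith
      then show False using extremal \<open>S = 0\<close> by simp
    qed
    moreover have "k \<noteq> M"
    proof
      assume "k = M"
      then have S: "S = M * M" using k by simp
      have eq: "M dvd 2 * t" if "4 * (t * t) = M * M" for t
      proof -
        have "\<bar>2 * t\<bar> * \<bar>2 * t\<bar> = M * M" using that by simp
        then have "(2 * t)\<^sup>2 = M\<^sup>2" by (simp add: power2_eq_square)
        then have "2 * t = M \<or> 2 * t = - M" by (simp only: power2_eq_iff)
        then show ?thesis by (elim disjE) simp_all
      qed
      have "4 * (w * w) = M * M" "4 * (x * x) = M * M" "4 * (y * y) = M * M" "4 * (z * z) = M * M"
        using S sqs unfolding S_def by linarith+
      then show False using extremal eq S by simp
    qed
    ultimately have k': "0 < k" "k < M" using k_le by auto
    \<comment> \<open>The four roots in Euler's identity are divisible by M: the first is congruent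
      to M p, and in the others the cross terms cancel modulo M.\<close>
    define A B C D where "A = a * w + b * x + c * y + d * z" and "B = a * x - b * w - c * z + d * y"
      and "C = a * y - c * w + b * z - d * x" and "D = a * z - d * w - b * y + c * x"
    have cross: "M dvd s * t' - s' * t" if "M dvd s - t" "M dvd s' - t'" for s t s' t'
    proof -
      have "M dvd s' * (s - t) - s * (s' - t')" 
        by (rule dvd_diff[OF dvd_mult[OF that(1)] dvd_mult[OF that(2)]])
      then show ?thesis by (simp add: algebra_simps)
    qed
    have "M dvd M * int p - (a * (a - w) + b * (b - x) + c * (c - y) + d * (d - z))"
      by (intro dvd_diff[OF dvd_triv_left] dvd_add dvd_mult w x y z)
    also have "\<dots> = A" unfolding abcd A_def by (simp add: algebra_simps)
    finally obtain A' where A: "A = M * A'" by blast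
    have "M dvd (a * x - b * w) - (c * z - d * y)" using w x y z by (intro dvd_diff[OF cross cross])
    also have "\<dots> = B" unfolding B_def by simp
    finally obtain B' where B: "B = M * B'" by blast
    have "M dvd (a * y - c * w) + (b * z - d * x)" using w x y z by (intro dvd_add[OF cross cross])
    also have "\<dots> = C" unfolding C_def by simp
    finally obtain C' where C: "C = M * C'" by blast
    have "M dvd (a * z - d * w) - (b * y - c * x)" using w x y z by (intro dvd_diff[OF cross cross])
    also have "\<dots> = D" unfolding D_def by simp
    finally obtain D' where D: "D = M * D'" by blast
    have "(M * int p) * S = A * A + B * B + C * C + D * D"
      unfolding abcd S_def A_def B_def C_def D_def by (rule euler_four_square_identity)
    then have "(M * M) * (k * int p) = (M * M) * (A' * A' + B' * B' + C' * C' + D' * D')"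
      unfolding A B C D k by (simp add: algebra_simps)
    then have "k * int p = A' * A' + B' * B' + C' * C' + D' * D'" using M by simp
    then have "sum4sq (k * int p)" unfolding sum4sq_def by blast
    then have "P (nat k)" using k' by (simp add: P_def)
    then have "m \<le> nat k" by (rule least)
    then show ?thesis using k' by (simp add: M_def)
  qed
qed

lemma sum4sq_nat: "sum4sq (int n)"
proof (induction n rule: less_induct)
  case (less n)
  consider "n = 0" | "n = 1" | "1 < n" by linarith
  then show ?case
  proof cases
    case 1
    then show ?thesis unfolding sum4sq_def by (intro exI[of _ 0]) simp
  next
    case 2
    then have "int n = 1 * 1 + 0 * 0 + 0 * 0 + 0 * 0" by simp
    then show ?thesis unfolding sum4sq_def by blast
  next
    case 3
    then obtain p where p: "prime p" "p dvd n" using prime_factor_nat[of n] by auto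
    then obtain k where k: "n = p * k" by blast
    have "1 < p" using p(1) by (rule prime_gt_1_nat)
    moreover have "0 < k" using 3 k by (cases k) auto
    ultimately have "k < n" by (simp add: k)
    with sum4sq_mult[OF sum4sq_prime[OF p(1)] less] show ?thesis by (simp add: k)
  qed
qed

section \<open>From the natural numbers to the integers\<close>

text \<open>From \<open>b\<close> on, ten auxiliary slots hold four roots, their squares and two
  partial sums.\<close>

definition nonneg_atoms :: "nat \<Rightarrow> nat \<Rightarrow> atom list" where
  "nonneg_atoms i b =
    [Mul b b (b + 4), Mul (b + 1) (b + 1) (b + 5), Mul (b + 2) (b + 2) (b + 6), Mul (b + 3) (b + 3) (b + 7),
     Add (b + 4) (b + 5) (b + 8), Add (b + 8) (b + 6) (b + 9), Add (b + 9) (b + 7) i]"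

lemma nonneg_atoms_imp_nonneg:
  fixes z :: "nat \<Rightarrow> int"
  assumes "\<forall>A\<in>set (nonneg_atoms i b). holds z A"
  shows "0 \<le> z i"
proof -
  have "z i = z b * z b + z (b + 1) * z (b + 1) + z (b + 2) * z (b + 2) + z (b + 3) * z (b + 3)"
    using assms by (simp add: nonneg_atoms_def)
  then show ?thesis by simp
qed

definition int_atoms :: "nat \<Rightarrow> atom list \<Rightarrow> atom list" where
  "int_atoms M E = E @ concat (map (\<lambda>i. nonneg_atoms i (M + 10 * i)) [0..<M])"

lemma vars_int_atoms:
  assumes "\<And>A. A \<in> set E \<Longrightarrow> vars A \<subseteq> {..<M}" "A \<in> set (int_atoms M E)"
  shows "vars A \<subseteq> {..<11 * M}"
  using assms(2)[unfolded int_atoms_def, simplified]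
proof
  assume "A \<in> set E"
  then show ?thesis using assms(1) by fastforce
next
  assume "\<exists>i\<in>{0..<M}. A \<in> set (nonneg_atoms i (M + 10 * i))"
  then show ?thesis by (auto simp: nonneg_atoms_def)
qed

lemma holds_of_nat: "holds (\<lambda>i. int (w i)) A \<longleftrightarrow> holds w A"
  by (cases A) (simp_all flip: of_nat_add of_nat_mult)

lemma int_atoms_correct:
  assumes E: "\<And>A. A \<in> set E \<Longrightarrow> vars A \<subseteq> {..<M}" and M: "0 < M"
  shows "(\<exists>w. w 0 = n \<and> (\<forall>A\<in>set E. holds w A)) \<longleftrightarrow>
    (\<exists>z :: nat \<Rightarrow> int. z 0 = int n \<and> (\<forall>A\<in>set (int_atoms M E). holds z A))" (is "?L \<longleftrightarrow> ?R")
proof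
  assume ?L
  then obtain w where w: "w 0 = n" "\<forall>A\<in>set E. holds w A" by blast
  have "\<exists>a b c d. int (w i) = a * a + b * b + c * c + d * d" for i
    using sum4sq_nat[of "w i"] unfolding sum4sq_def .
  then obtain a b c d where sq: "\<And>i. int (w i) = a i * a i + b i * b i + c i * c i + d i * d i" by metis
  define aux where "aux i = [a i, b i, c i, d i, a i * a i, b i * b i, c i * c i, d i * d i,
     a i * a i + b i * b i, a i * a i + b i * b i + c i * c i]" for i
  define z where "z j = (if j < M then int (w j) else aux ((j - M) div 10) ! ((j - M) mod 10))" for j
  have z: "z (M + 10 * i + t) = aux i ! t" if "t < 10" for i t
    using that by (simp add: z_def)
  have "holds z A" if "A \<in> set (nonneg_atoms i (M + 10 * i))" "i < M" for A i
  proof -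
    have "z i = a i * a i + b i * b i + c i * c i + d i * d i"
      using that(2) sq by (simp add: z_def)
    then show ?thesis
      using that(1) z[of 0 i] z[of 1 i] z[of 2 i] z[of 3 i] z[of 4 i] z[of 5 i] z[of 6 i] z[of 7 i] z[of 8 i] z[of 9 i]
      unfolding nonneg_atoms_def aux_def by auto
  qed
  moreover have "holds z A" if "A \<in> set E" for A
  proof -
    have "holds z A \<longleftrightarrow> holds (\<lambda>i. int (w i)) A"
      by (rule holds_cong) (use E[OF that] in \<open>auto simp: z_def\<close>)
    then show ?thesis using w(2) that by (simp add: holds_of_nat)
  qed
  moreover have "z 0 = int n" using M w(1) by (simp add: z_def)
  ultimately show ?R by (intro exI[of _ z]) (auto simp: int_atoms_def)
next
  assume ?R
  then obtain z :: "nat \<Rightarrow> int" where z: "z 0 = int n" "\<forall>A\<in>set (int_atoms M E). holds z A" by blast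
  have nonneg: "0 \<le> z i" if "i < M" for i
    using z(2) that by (intro nonneg_atoms_imp_nonneg[of i "M + 10 * i"]) (auto simp: int_atoms_def)
  have "holds (\<lambda>i. nat (z i)) A" if "A \<in> set E" for A
  proof -
    have "holds z A \<longleftrightarrow> holds (\<lambda>i. nat (z i)) A"
      unfolding holds_of_nat[symmetric] by (rule holds_cong) (use E[OF that] nonneg in auto)
    then show ?thesis using z(2) that by (simp add: int_atoms_def)
  qed
  then show ?L using z(1) by (intro exI[of _ "\<lambda>i. nat (z i)"]) simp
qed

section \<open>Bilinear systems over the integers\<close>

type_synonym equation = "(nat \<Rightarrow> nat \<Rightarrow> int) \<times> int"

definition bilin :: "nat \<Rightarrow> (nat \<Rightarrow> nat \<Rightarrow> int) \<Rightarrow> (nat \<Rightarrow> int) \<Rightarrow> (nat \<Rightarrow> int) \<Rightarrow> int" where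
  "bilin r \<alpha> x y = (\<Sum>i<r. \<Sum>j<r. \<alpha> i j * (x i * y j))"

definition unit_coeff :: "nat \<Rightarrow> nat \<Rightarrow> nat \<Rightarrow> nat \<Rightarrow> int" where
  "unit_coeff i j k l = (if k = i \<and> l = j then 1 else 0)"

lemma bilin_unit_coeff: "i < r \<Longrightarrow> j < r \<Longrightarrow> bilin r (unit_coeff i j) x y = x i * y j"
proof -
  assume "i < r" "j < r"
  have "bilin r (unit_coeff i j) x y = (\<Sum>k<r. \<Sum>l<r. if k = i then if l = j then x k * y l else 0 else 0)"
    unfolding bilin_def unit_coeff_def by (intro sum.cong refl) auto
  also have "\<dots> = (\<Sum>k<r. if k = i then (\<Sum>l<r. if l = j then x k * y l else 0) else 0)"
    by (intro sum.cong refl) simp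
  finally have "bilin r (unit_coeff i j) x y =
    (\<Sum>k<r. if k = i then (\<Sum>l<r. if l = j then x k * y l else 0) else 0)" .
  then show ?thesis using \<open>i < r\<close> \<open>j < r\<close> by simp
qed

lemma bilin_add: "bilin r (\<lambda>k l. \<alpha> k l + \<beta> k l) x y = bilin r \<alpha> x y + bilin r \<beta> x y"
  unfolding bilin_def by (simp add: algebra_simps sum.distrib)

lemma bilin_diff: "bilin r (\<lambda>k l. \<alpha> k l - \<beta> k l) x y = bilin r \<alpha> x y - bilin r \<beta> x y"
  unfolding bilin_def by (simp add: algebra_simps sum_subtractf)

lemma bilin_scale: "bilin r (\<lambda>k l. c * \<alpha> k l) x y = c * bilin r \<alpha> x y"
  unfolding bilin_def by (simp add: sum_distrib_left mult.assoc)

text \<open>Index 0 is reserved for a unit, forced by \<open>x 0 * y 0 = 1\<close>; the product \<open>x (Suc i) * y 0\<close> plays the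
  role of the \<open>i\<close>-th variable, which takes care of the sign ambiguity of the unit.\<close>

fun atom_equation :: "atom \<Rightarrow> equation" where
  "atom_equation (Add i j k) =
    (\<lambda>m l. unit_coeff (Suc i) 0 m l + unit_coeff (Suc j) 0 m l - unit_coeff (Suc k) 0 m l, 0)"
| "atom_equation (Mul i j k) = (\<lambda>m l. unit_coeff (Suc i) (Suc j) m l - unit_coeff (Suc k) 0 m l, 0)"
| "atom_equation (One i) = (unit_coeff (Suc i) 0, 1)"

text \<open>The number \<open>n\<close> occurs only in the first equation, as the coefficient at (0,
  0), and in no right-hand side. The encoding of the parameter in the system code depends on
  this.\<close>

definition equations :: "nat \<Rightarrow> atom list \<Rightarrow> nat \<Rightarrow> equation list" where
  "equations K E n = (\<lambda>m l. int n * unit_coeff 0 0 m l - unit_coeff 1 0 m l, 0) # (unit_coeff 0 0, 1) #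
     map (\<lambda>i. (\<lambda>m l. unit_coeff (Suc i) 0 m l - unit_coeff 0 (Suc i) m l, 0)) [0..<K] @ map atom_equation E"

lemma equations_solvable_iff:
  assumes E: "\<And>A. A \<in> set E \<Longrightarrow> vars A \<subseteq> {..<K}" and K: "0 < K"
  shows "(\<exists>x y. \<forall>e\<in>set (equations K E n). bilin (Suc K) (fst e) x y = snd e) \<longleftrightarrow>
    (\<exists>z :: nat \<Rightarrow> int. z 0 = int n \<and> (\<forall>A\<in>set E. holds z A))" (is "?L \<longleftrightarrow> ?R")
proof -
  have eqs: "(\<forall>e\<in>set (equations K E n). bilin (Suc K) (fst e) x y = snd e) \<longleftrightarrow>
    int n * (x 0 * y 0) = x 1 * y 0 \<and> x 0 * y 0 = 1 \<and> (\<forall>i<K. x (Suc i) * y 0 = x 0 * y (Suc i)) \<and>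
    (\<forall>A\<in>set E. bilin (Suc K) (fst (atom_equation A)) x y = snd (atom_equation A))" for x y
    using K by (auto simp: equations_def ball_Un bilin_diff bilin_scale bilin_unit_coeff)
  have atom: "bilin (Suc K) (fst (atom_equation A)) x y = snd (atom_equation A) \<longleftrightarrow>
      holds (\<lambda>i. x (Suc i) * y 0) A"
    if "x 0 * y 0 = 1" "\<forall>i<K. x (Suc i) * y 0 = x 0 * y (Suc i)" "A \<in> set E" for x y A
  proof -
    \<comment> \<open>Insert the factor \<open>x 0 * y 0 = 1\<close> and exchange
      \<open>x 0 * y (Suc j)\<close> for \<open>x (Suc j) * y 0\<close>.\<close>
    have prod: "x (Suc i) * y (Suc j) = x (Suc i) * y 0 * (x (Suc j) * y 0)" if "j < K" for i j
    proof -
      have "x (Suc i) * y 0 * (x (Suc j) * y 0) = x (Suc i) * y (Suc j) * (x 0 * y 0)"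
        using \<open>\<forall>i<K. _\<close> that by simp
      then show ?thesis by (simp only: \<open>x 0 * y 0 = 1\<close> mult_1_right)
    qed
    show ?thesis
    proof (cases A)
      case (Mul i j k)
      then have "i < K" "j < K" "k < K" using E[OF that(3)] by auto
      then have "bilin (Suc K) (fst (atom_equation A)) x y = x (Suc i) * y 0 * (x (Suc j) * y 0) - x (Suc k) * y 0"
        using Mul prod by (simp add: bilin_diff bilin_unit_coeff)
      then show ?thesis by (simp add: Mul)
    qed (use E[OF that(3)] in \<open>auto simp: bilin_diff bilin_add bilin_unit_coeff\<close>)
  qed
  show ?thesis
  proof
    assume ?L
    then obtain x y where xy: "int n * (x 0 * y 0) = x 1 * y 0" "x 0 * y 0 = 1"
      "\<forall>i<K. x (Suc i) * y 0 = x 0 * y (Suc i)"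
      "\<forall>A\<in>set E. bilin (Suc K) (fst (atom_equation A)) x y = snd (atom_equation A)"
      unfolding eqs by blast
    then show ?R using atom[OF xy(2,3)] by (intro exI[of _ "\<lambda>i. x (Suc i) * y 0"]) simp
  next
    assume ?R
    then obtain z :: "nat \<Rightarrow> int" where z: "z 0 = int n" "\<forall>A\<in>set E. holds z A" by blast
    define x where "x = case_nat 1 z"
    have "\<forall>A\<in>set E. bilin (Suc K) (fst (atom_equation A)) x x = snd (atom_equation A)"
      using atom[of x x] z(2) by (simp add: x_def)
    moreover have "x 0 = 1" "x 1 = int n" using z(1) by (simp_all add: x_def)
    ultimately show ?L using eqs[of x x] by auto
  qed
qed

section \<open>Forms of rank one\<close>

lemma rank_one_factor:
  fixes A :: "rat^'n^'m"
  assumes "rank A = 1"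
  obtains p q where "\<And>i j. A $ i $ j = p i * q j" "A \<noteq> 0"
proof -
  have "vec.dim (rows A) = 1" using assms by (simp add: row_rank_def_gen)
  moreover obtain S where S: "S \<subseteq> rows A" "vec.independent S" "rows A \<subseteq> vec.span S" "card S = vec.dim (rows A)"
    using vec.basis_exists by blast
  ultimately obtain b where b: "S = {b}" by (metis card_1_singletonE)
  have "\<exists>c. row i A = c *s b" for i
    using S(3) unfolding b vec.span_singleton by (auto simp: rows_def)
  then obtain p where p: "\<And>i. row i A = p i *s b" by metis
  have Aij: "A $ i $ j = p i * b $ j" for i j
    using arg_cong[OF p[of i], of "\<lambda>r. r $ j"] by (simp add: row_def)
  have "b \<noteq> 0" using S(2) b vec.dependent_zero by auto
  moreover obtain i where "b = row i A" using S(1) b by (auto simp: rows_def)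
  ultimately have "A \<noteq> 0" by (auto simp: row_def vec_eq_iff)
  with Aij show thesis by (rule that)
qed

text \<open>Over the rationals a factorization is immediate. Its integral trace is the vanishing of
  all 2 by 2 minors, and the minimality of \<open>d\<close> makes the factors integral.\<close>

lemma form_rank_one:
  fixes \<beta> :: "int^'m \<Rightarrow> int^'n \<Rightarrow> int"
  assumes add1: "\<And>u u' v. \<beta> (u + u') v = \<beta> u v + \<beta> u' v" and scale1: "\<And>c u v. \<beta> (c *s u) v = c * \<beta> u v"
    and add2: "\<And>u v v'. \<beta> u (v + v') = \<beta> u v + \<beta> u v'" and scale2: "\<And>c u v. \<beta> u (c *s v) = c * \<beta> u v"
    and rank: "form_rank \<beta> = 1"
  obtains d e f X Y where "d \<noteq> 0" "\<And>u v. \<beta> u v = d * (X u * Y v)" "X e = 1" "Y f = 1"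
proof -
  have zero: "\<beta> 0 v = 0" "\<beta> u 0 = 0" for u v
    using scale1[of 0 0 v] scale2[of u 0 0] by simp_all
  have sum1: "\<beta> (\<Sum>i\<in>I. g i) v = (\<Sum>i\<in>I. \<beta> (g i) v)" if "finite I" for I :: "'m set" and g v
    using that by induction (simp_all add: zero add1)
  have sum2: "\<beta> u (\<Sum>j\<in>I. g j) = (\<Sum>j\<in>I. \<beta> u (g j))" if "finite I" for I :: "'n set" and g u
    using that by induction (simp_all add: zero add2)
  have expand: "\<beta> u v = (\<Sum>i\<in>UNIV. \<Sum>j\<in>UNIV. u $ i * (v $ j * form_matrix \<beta> $ i $ j))" for u v
  proof -
    have "\<beta> u v = \<beta> (\<Sum>i\<in>UNIV. u $ i *s axis i 1) (\<Sum>j\<in>UNIV. v $ j *s axis j 1)"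
      by (simp only: basis_expansion)
    also have "\<dots> = (\<Sum>i\<in>UNIV. \<Sum>j\<in>UNIV. u $ i * (v $ j * form_matrix \<beta> $ i $ j))"
      by (simp add: sum1 sum2 scale1 scale2 form_matrix_def sum_distrib_left, subst sum.swap,
          simp add: mult.left_commute)
    finally show ?thesis .
  qed
  obtain p q where pq: "\<And>i j. (\<chi> i j. rat_of_int (form_matrix \<beta> $ i $ j)) $ i $ j = p i * q j"
    and nz: "(\<chi> i j. rat_of_int (form_matrix \<beta> $ i $ j)) \<noteq> 0"
    using rank_one_factor[OF rank[unfolded form_rank_def]] by blast
  define P Q where "P u = (\<Sum>i\<in>UNIV. rat_of_int (u $ i) * p i)"
    and "Q v = (\<Sum>j\<in>UNIV. rat_of_int (v $ j) * q j)" for u :: "int^'m" and v :: "int^'n"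
  have PQ: "rat_of_int (\<beta> u v) = P u * Q v" for u v
  proof -
    have "rat_of_int (form_matrix \<beta> $ i $ j) = p i * q j" for i j using pq[of i j] by simp
    then have "rat_of_int (\<beta> u v) =
        (\<Sum>i\<in>UNIV. \<Sum>j\<in>UNIV. rat_of_int (u $ i) * (rat_of_int (v $ j) * (p i * q j)))"
      by (simp add: expand[of u v])
    also have "\<dots> = P u * Q v"
      unfolding P_def Q_def sum_product by (intro sum.cong refl) (simp only: mult_ac)
    finally show ?thesis .
  qed
  have minor: "\<beta> u v * \<beta> u' v' = \<beta> u v' * \<beta> u' v" for u v u' v'
  proof -
    have "rat_of_int (\<beta> u v * \<beta> u' v') = rat_of_int (\<beta> u v' * \<beta> u' v)" by (simp add: PQ)
    then show ?thesis by (simp only: of_int_eq_iff)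
  qed
  have "\<exists>u v. \<beta> u v \<noteq> 0" using nz by (auto simp: vec_eq_iff form_matrix_def)
  then obtain e f where ef: "\<beta> e f \<noteq> 0" and min: "\<And>u v. \<beta> u v \<noteq> 0 \<Longrightarrow> nat \<bar>\<beta> e f\<bar> \<le> nat \<bar>\<beta> u v\<bar>"
    using ex_has_least_nat[of "\<lambda>(u, v). \<beta> u v \<noteq> 0" _ "\<lambda>(u, v). nat \<bar>\<beta> u v\<bar>"] by fastforce
  define d where "d = \<beta> e f"
  have d: "d \<noteq> 0" using ef by (simp add: d_def)
  have min0: "\<beta> u v = 0" if "\<bar>\<beta> u v\<bar> < \<bar>d\<bar>" for u v
  proof (rule ccontr)
    assume "\<beta> u v \<noteq> 0"
    from min[OF this] that show False by (simp add: d_def nat_le_eq_zle)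
  qed
  \<comment> \<open>Subtracting a multiple of \<open>e\<close> from \<open>u\<close> turns the
    remainder modulo \<open>d\<close> into a value of the form, which minimality forces to be
    0.\<close>
  have dvd1: "d dvd \<beta> u f" for u
  proof -
    have "\<beta> (u + (- (\<beta> u f div d)) *s e) f = \<beta> u f mod d"
      unfolding add1 scale1 d_def[symmetric] by (simp add: minus_mult_div_eq_mod[symmetric] mult.commute)
    moreover have "\<bar>\<beta> u f mod d\<bar> < \<bar>d\<bar>" using d by (rule abs_mod_less)
    ultimately have "\<beta> u f mod d = 0" using min0 by metis
    then show ?thesis by (simp add: dvd_eq_mod_eq_0)
  qed
  have dvd2: "d dvd \<beta> e v" for v
  proof -
    have "\<beta> e (v + (- (\<beta> e v div d)) *s f) = \<beta> e v mod d"
      unfolding add2 scale2 d_def[symmetric] by (simp add: minus_mult_div_eq_mod[symmetric] mult.commute)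
    moreover have "\<bar>\<beta> e v mod d\<bar> < \<bar>d\<bar>" using d by (rule abs_mod_less)
    ultimately have "\<beta> e v mod d = 0" using min0 by metis
    then show ?thesis by (simp add: dvd_eq_mod_eq_0)
  qed
  define X Y where "X u = \<beta> u f div d" and "Y v = \<beta> e v div d" for u v
  have XY: "\<beta> u f = d * X u" "\<beta> e v = d * Y v" for u v
    using dvd1 dvd2 by (simp_all add: X_def Y_def)
  have "\<beta> u v = d * (X u * Y v)" for u v
  proof -
    have "d * \<beta> u v = \<beta> u f * \<beta> e v"
      using minor[of u v e f] by (simp only: d_def mult.commute)
    also have "\<dots> = d * (d * (X u * Y v))" unfolding XY by (simp only: mult_ac)
    finally have "d * \<beta> u v = d * (d * (X u * Y v))" .
    then show ?thesis using d by simp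
  qed
  moreover have "X e = 1" "Y f = 1" using d by (simp_all add: X_def Y_def d_def)
  ultimately show thesis using that d by blast
qed

section \<open>Reduction from scalar to vector systems\<close>

definition vector_system :: "nat \<Rightarrow> equation list \<Rightarrow> int^'p \<Rightarrow> 'p::finite bilinear_system" where
  "vector_system r es c = \<lparr>sys_r = r, sys_s = length es, sys_a = (\<lambda>q. fst (es ! q)), sys_c = (\<lambda>q. snd (es ! q) *s c)\<rparr>"

lemma int_bilinearD:
  assumes "int_bilinear B"
  shows "B (u + u') v = B u v + B u' v" "B (c *s u) v = c *s B u v"
    "B u (v + v') = B u v + B u v'" "B u (c *s v) = c *s B u v"
proof -
  have 1: "module_hom (*s) (*s) (\<lambda>u. B u v)" and 2: "module_hom (*s) (*s) (B u)" for u v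
    using assms by (simp_all add: int_bilinear_def int_linear_def)
  show "B (u + u') v = B u v + B u' v" "B (c *s u) v = c *s B u v"
    using module_hom.add[OF 1] module_hom.scale[OF 1] by auto
  show "B u (v + v') = B u v + B u v'" "B u (c *s v) = c *s B u v"
    using module_hom.add[OF 2] module_hom.scale[OF 2] by auto
qed

lemma solvable_vector_system:
  fixes B :: "int^'m \<Rightarrow> int^'n \<Rightarrow> int^'p"
  assumes B: "int_bilinear B" and L: "int_functional L"
    and d: "d \<noteq> 0" and LB: "\<And>u v. L (B u v) = d * (X u * Y v)" and e: "X e = 1" and f: "Y f = 1"
  shows "solvable B (vector_system r es (B e f)) \<longleftrightarrow> (\<exists>x y. \<forall>e\<in>set es. bilin r (fst e) x y = snd e)"
    (is "?L \<longleftrightarrow> ?R")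
proof
  assume ?L
  then obtain u v where uv: "\<And>q. q < length es \<Longrightarrow>
      (\<Sum>i<r. \<Sum>j<r. fst (es ! q) i j *s B (u i) (v j)) = snd (es ! q) *s B e f"
    by (auto simp: solvable_def vector_system_def)
  have Lh: "L (\<Sum>i\<in>I. g i) = (\<Sum>i\<in>I. L (g i))" "L (c *s w) = c * L w" for I :: "nat set" and g c w
    using L by (simp_all add: int_functional_def module_hom.sum module_hom.scale)
  have "bilin r (fst (es ! q)) (\<lambda>i. X (u i)) (\<lambda>j. Y (v j)) = snd (es ! q)" if "q < length es" for q
  proof -
    have "d * bilin r (fst (es ! q)) (\<lambda>i. X (u i)) (\<lambda>j. Y (v j)) =
        L (\<Sum>i<r. \<Sum>j<r. fst (es ! q) i j *s B (u i) (v j))"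
      by (simp add: Lh LB bilin_def sum_distrib_left mult_ac)
    also have "\<dots> = d * snd (es ! q)" unfolding uv[OF that] by (simp add: Lh LB e f)
    finally show ?thesis using d by simp
  qed
  then show ?R by (metis in_set_conv_nth)
next
  assume ?R
  then obtain x y where xy: "\<forall>e\<in>set es. bilin r (fst e) x y = snd e" by blast
  have scale: "B (a *s e) (b *s f) = (a * b) *s B e f" for a b
    by (simp add: int_bilinearD[OF B] vector_smult_assoc mult.commute)
  have "(\<Sum>i<r. \<Sum>j<r. fst (es ! q) i j *s B (x i *s e) (y j *s f)) = snd (es ! q) *s B e f" if "q < length es" for q
  proof -
    have "(\<Sum>i<r. \<Sum>j<r. fst (es ! q) i j *s B (x i *s e) (y j *s f)) = bilin r (fst (es ! q)) x y *s B e f"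
      unfolding scale bilin_def by (simp add: vec_eq_iff sum_distrib_right mult.assoc)
    then show ?thesis using xy that by simp
  qed
  then show ?L
    unfolding solvable_def vector_system_def
    by (intro exI[of _ "\<lambda>i. x i *s e"] exI[of _ "\<lambda>j. y j *s f"]) simp
qed

section \<open>Codes\<close>

lemma system_data_first:
  fixes S S' :: "'p::finite bilinear_system"
  assumes "sys_r S > 0" "sys_s S > 0" "sys_r S' = sys_r S" "sys_s S' = sys_s S" "sys_c S' = sys_c S"
    and "\<And>q i j. q \<noteq> 0 \<or> i \<noteq> 0 \<or> j \<noteq> 0 \<Longrightarrow> sys_a S' q i j = sys_a S q i j"
  shows "\<exists>xs. system_data S = sys_a S 0 0 0 # xs \<and> system_data S' = sys_a S' 0 0 0 # xs"
proof -
  define body where "body T q = concat (map (\<lambda>i. map (\<lambda>j. sys_a T q i j) [0..<sys_r S]) [0..<sys_r S])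
      @ coords (sys_c S q)" for T :: "'p bilinear_system" and q
  have r: "[0..<sys_r S] = 0 # [1..<sys_r S]" and s: "[0..<sys_s S] = 0 # [1..<sys_s S]"
    using assms(1,2) by (simp_all add: upt_conv_Cons)
  have "\<forall>q i j. q \<noteq> 0 \<or> i \<noteq> 0 \<or> j \<noteq> 0 \<longrightarrow> sys_a S' q i j = sys_a S q i j" using assms(6) by blast
  then have rows: "map (\<lambda>i. map (\<lambda>j. sys_a S' 0 i j) [0..<sys_r S]) [1..<sys_r S] =
      map (\<lambda>i. map (\<lambda>j. sys_a S 0 i j) [0..<sys_r S]) [1..<sys_r S]"
    and row: "map (\<lambda>j. sys_a S' 0 0 j) [1..<sys_r S] = map (\<lambda>j. sys_a S 0 0 j) [1..<sys_r S]"
    and bodies: "map (body S') [1..<sys_s S] = map (body S) [1..<sys_s S]"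
    by (auto simp: body_def intro!: arg_cong[where f = concat])
  define xs where "xs = map (\<lambda>j. sys_a S 0 0 j) [1..<sys_r S] @
      concat (map (\<lambda>i. map (\<lambda>j. sys_a S 0 i j) [0..<sys_r S]) [1..<sys_r S]) @ coords (sys_c S 0)
      @ concat (map (body S) [1..<sys_s S])"
  have body0: "body T 0 = sys_a T 0 0 0 # map (\<lambda>j. sys_a T 0 0 j) [1..<sys_r S] @
      concat (map (\<lambda>i. map (\<lambda>j. sys_a T 0 i j) [0..<sys_r S]) [1..<sys_r S]) @ coords (sys_c S 0)" for T
  proof -
    have "map (\<lambda>i. map (\<lambda>j. sys_a T 0 i j) [0..<sys_r S]) [0..<sys_r S] =
      (sys_a T 0 0 0 # map (\<lambda>j. sys_a T 0 0 j) [1..<sys_r S]) #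
        map (\<lambda>i. map (\<lambda>j. sys_a T 0 i j) [0..<sys_r S]) [1..<sys_r S]"
      by (subst (2) r) (simp add: r)
    then show ?thesis unfolding body_def by simp
  qed
  have "system_data S = concat (map (body S) [0..<sys_s S])" "system_data S' = concat (map (body S') [0..<sys_s S])"
    unfolding system_data_def body_def assms(3-5) by (rule refl)+
  then have "system_data S = sys_a S 0 0 0 # xs" "system_data S' = sys_a S' 0 0 0 # xs"
    unfolding s list.map concat.simps body0 bodies rows row xs_def by simp_all
  then show ?thesis by blast
qed

lemma int_encode_nat: "int_encode (int n) = 2 * n"
  by (simp add: int_encode_def sum_encode_def)

text \<open>The order of quantifiers is essential: \<open>r\<close>, \<open>s\<close> and
  \<open>t\<close> do not depend on \<open>n\<close>. Here \<open>t\<close> codes the data after the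
  first coefficient, and \<open>2 * n\<close> is the code of the integer \<open>n\<close>.\<close>

lemma code_vector_system_equations:
  "\<exists>r s t. r > 0 \<and> s > 0 \<and> (\<forall>n.
    sys_r (vector_system (Suc K) (equations K E n) c) = r \<and>
    sys_s (vector_system (Suc K) (equations K E n) c) = s \<and>
    system_code (vector_system (Suc K) (equations K E n) c) =
      Suc (prod_encode (r, Suc (prod_encode (s, Suc (prod_encode (2 * n, t)))))))"
proof -
  define T where "T n = vector_system (Suc K) (equations K E n) c" for n
  define s where "s = length (equations K E 0)"
  have len: "length (equations K E n) = s" for n by (simp add: equations_def s_def)
  have T: "sys_r (T n) = Suc K" "sys_s (T n) = s" "sys_a (T n) 0 0 0 = int n" "sys_c (T n) = sys_c (T 0)"
    "q \<noteq> 0 \<or> i \<noteq> 0 \<or> j \<noteq> 0 \<Longrightarrow> sys_a (T n) q i j = sys_a (T 0) q i j" for n q i j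
    by (auto simp: T_def vector_system_def s_def equations_def unit_coeff_def nth_Cons split: nat.splits)
  have "s > 0" by (simp add: s_def equations_def)
  define xs where "xs = tl (system_data (T 0))"
  have data: "system_data (T n) = int n # xs" for n
  proof -
    have "\<exists>ys. system_data (T 0) = sys_a (T 0) 0 0 0 # ys \<and> system_data (T n) = sys_a (T n) 0 0 0 # ys"
    proof (rule system_data_first)
      show "sys_c (T n) = sys_c (T 0)" by (rule T(4))
      show "sys_a (T n) q i j = sys_a (T 0) q i j" if "q \<noteq> 0 \<or> i \<noteq> 0 \<or> j \<noteq> 0" for q i j
        using that by (rule T(5))
    qed (use \<open>s > 0\<close> in \<open>simp_all add: T(1,2)\<close>)
    then show ?thesis by (auto simp: xs_def T(3))
  qed
  have "system_code (T n) = Suc (prod_encode (Suc K, Suc (prod_encode (s, Suc (prod_encode (2 * n, list_encode (map int_encode xs)))))))" for n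
    unfolding system_code_def data T(1,2) by (simp add: int_encode_nat)
  then show ?thesis using T(1,2) \<open>s > 0\<close> unfolding T_def by blast
qed

lemma dfun_prod_encode:
  "dfun f \<Longrightarrow> dfun g \<Longrightarrow> dfun (\<lambda>v. prod_encode (f v, g v))"
  unfolding prod_encode_def triangle_def case_prod_conv by (intro dioph_intros) simp_all

theorem proposition7p7:
  fixes B :: "int^'m \<Rightarrow> int^'n \<Rightarrow> int^'p"
  assumes "int_bilinear B"
    and "\<exists>L :: int^'p \<Rightarrow> int. int_functional L \<and> form_rank (\<lambda>u v. L (B u v)) = 1"
  shows "undecidable bilinear_systems system_code (solvable B)"
  unfolding undecidable_def
proof
  assume "\<exists>f. decides f bilinear_systems system_code (solvable B)"
  then obtain F where F: "decides F bilinear_systems system_code (solvable B)" by blast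
  obtain L :: "int^'p \<Rightarrow> int" where L: "int_functional L" "form_rank (\<lambda>u v. L (B u v)) = 1"
    using assms(2) by blast
  have lin: "B (u + u') v = B u v + B u' v" "B (c *s u) v = c *s B u v"
    "B u (v + v') = B u v + B u v'" "B u (c *s v) = c *s B u v"
    "L (w + w') = L w + L w'" "L (c *s w) = c * L w" for u u' v v' w w' c
    using int_bilinearD[OF assms(1)] L(1)
    by (simp_all add: int_functional_def module_hom.add module_hom.scale)
  obtain d e f X Y where "d \<noteq> 0" "\<And>u v. L (B u v) = d * (X u * Y v)" "X e = 1" "Y f = 1"
    by (rule form_rank_one[of "\<lambda>u v. L (B u v)"]) (use L(2) in \<open>simp_all add: lin\<close>)
  note solvable_iff = solvable_vector_system[OF assms(1) L(1) this]
  define D where "D n \<longleftrightarrow> (\<exists>r s t. n = prod_encode (r, prod_encode (s, t)) \<and>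
    rec_eval F [Suc (prod_encode (r, Suc (prod_encode (s, Suc (prod_encode (2 * n, t))))))] 0)" for n
  have "dioph (\<lambda>v. D (v 0))"
    unfolding D_def by (intro dioph_intros dfun_prod_encode)
  then obtain E M where M: "1 \<le> M" and E: "\<And>A. A \<in> set E \<Longrightarrow> vars A \<subseteq> {..<M}"
    and DE: "\<And>v. D (v 0) \<longleftrightarrow> (\<exists>w. (\<forall>i<1. w i = v i) \<and> (\<forall>A\<in>set E. holds w A))"
    by (rule dioph_prenex[of _ "\<lambda>_. 0" 1]) auto
  define T where "T n = vector_system (Suc (11 * M)) (equations (11 * M) (int_atoms M E) n) (B e f)" for n
  have solv: "solvable B (T n) \<longleftrightarrow> D n" for n
  proof -
    have "solvable B (T n) \<longleftrightarrow>
        (\<exists>z :: nat \<Rightarrow> int. z 0 = int n \<and> (\<forall>A\<in>set (int_atoms M E). holds z A))"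
      unfolding T_def solvable_iff by (intro equations_solvable_iff vars_int_atoms[OF E]) (use M in auto)
    also have "\<dots> \<longleftrightarrow> (\<exists>w. w 0 = n \<and> (\<forall>A\<in>set E. holds w A))"
      using int_atoms_correct[OF E, where n = n] M by simp
    also have "\<dots> \<longleftrightarrow> D n" using DE[of "\<lambda>_. n"] by simp
    finally show ?thesis .
  qed
  obtain r s t where rst: "r > 0" "s > 0" "\<And>n. sys_r (T n) = r" "\<And>n. sys_s (T n) = s"
    "\<And>n. system_code (T n) = Suc (prod_encode (r, Suc (prod_encode (s, Suc (prod_encode (2 * n, t))))))"
    using code_vector_system_equations[of "11 * M" "int_atoms M E" "B e f"] unfolding T_def by metis
  define n where "n = prod_encode (r, prod_encode (s, t))"
  \<comment> \<open>Pairing is injective, so the triple quantified in \<open>D\<close> must be this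
    one.\<close>
  have "D n \<longleftrightarrow> rec_eval F [system_code (T n)] 0"
    unfolding D_def rst(5) by (auto simp: n_def inj_eq[OF inj_prod_encode] prod_encode_eq)
  moreover have "rec_eval F [system_code (T n)] (if D n then 1 else 0)"
    using F rst(1-4) unfolding decides_def bilinear_systems_def solv[symmetric] by simp
  ultimately show False
    \<comment> \<open>If \<open>D n\<close> holds, \<open>F\<close> answers both 0 and 1 on the same
      code; otherwise it answers 0, which is \<open>D n\<close>.\<close>
    by (cases "D n") (auto dest: rec_eval_deterministic)
qed

end
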